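(* Let $I=\mathbb{2}$, and let $\mathcal{A}$ be the $2$-category generated by objects $X,A,B$; morphisms $\alpha_0\colon X\to A$, $\alpha_1\colon X\to B$ and $f\colon A\to B$; and a $2$-morphism $\alpha\colon f\alpha_0\Rightarrow\alpha_1$. Consider the $2$-functor $f\colon\mathbb{2}\to\mathcal{A}$ given by the morphism $f\colon A\to B$, and let $\mathrm{id}_f\colon\Delta A\Rightarrow f$ be the lax-cone with components $\mathrm{id}_A\colon A\to A$ and $f\colon A\to B$ and with $2$-morphism component $\mathrm{id}_f$. Then $(A,\mathrm{id}_f)$ is $2$-terminal in the lax-slice of lax-cones over $f$, but the functor $(\mathrm{id}_f)_*\circ\Delta\colon\mathcal{A}(X,A)\to\mathrm{Lax}[\mathbb{2},\mathcal{A}](\Delta X,f)$ is not surjective on objects; i.e. $(A,\mathrm{id}_f)$ is not a lax-limit of $f$.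
   Context: $\mathbb{2}$ is the category $\{0\to1\}$, regarded as a $2$-category with only identity $2$-morphisms. $2$-categories and $2$-functors are strict; $*$ denotes horizontal composition (and whiskering) of $2$-morphisms and juxtaposition denotes vertical composition. "Generated by the data" means the $2$-category freely generated by the listed objects, morphisms and $2$-morphisms. A lax-natural transformation $\mu\colon F\Rightarrow G$ between $2$-functors $F,G\colon I\to\mathcal{A}$ consists of morphisms $\mu_i\colon Fi\to Gi$ for $i\in I$ and $2$-morphisms $\mu_f\colon(Gf)\mu_i\Rightarrow\mu_j(Ff)$ for $f\colon i\to j$ in $I$, such that $\mu_{\mathrm{id}_i}=\mathrm{id}_{\mu_i}$, $\mu_{gf}=(\mu_g*Ff)(Gg*\mu_f)$ for composable $f,g$, and $\mu_g(G\alpha*\mu_i)=(\mu_j*F\alpha)\mu_f$ for every $2$-morphism $\alpha\colon f\Rightarrow g$ in $I$. A modification $\varphi\colon\mu\to\nu$ consists of $2$-morphisms $\varphi_i\colon\mu_i\Rightarrow\nu_i$ with $\nu_f(Gf*\varphi_i)=(\varphi_j*Ff)\mu_f$ for every $f\colon i\to j$. $\mathrm{Lax}[I,\mathcal{A}]$ is the $2$-category of $2$-functors, lax-natural transformations and modifications. $\Delta X$ is the constant $2$-functor at $X$; a lax-cone over a $2$-functor $F$ is a lax-natural transformation $\Delta X\Rightarrow F$. A lax-limit of $F$ is a pair $(L,\lambda\colon\Delta L\Rightarrow F)$ with $\lambda$ a lax-cone such that for each $X\in\mathcal{A}$ the functor $\lambda_*\circ\Delta\colon\mathcal{A}(X,L)\to\mathrm{Lax}[I,\mathcal{A}](\Delta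 X,F)$, given by post-composition with $\lambda$, is an isomorphism of categories. The lax-slice of lax-cones over $F$ is the $2$-category whose objects are pairs $(X,\mu)$ with $\mu\colon\Delta X\Rightarrow F$ a lax-cone; morphisms $(X,\mu)\to(Y,\nu)$ are pairs $(h,\varphi)$ of a morphism $h\colon X\to Y$ in $\mathcal{A}$ and a modification $\varphi\colon\nu\Delta h\to\mu$; $2$-morphisms $(h,\varphi)\Rightarrow(k,\psi)$ are $2$-morphisms $\beta\colon h\Rightarrow k$ in $\mathcal{A}$ with $\psi(\nu*\Delta\beta)=\varphi$. An object $L$ of a $2$-category $\mathcal{B}$ is $2$-terminal if for all $X\in\mathcal{B}$ the category $\mathcal{B}(X,L)$ is isomorphic to the terminal category $\mathbb{1}$. *)

theory Defs
  imports "HOL-Library.FuncSet"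
begin

section \<open>Categories\<close>

record ('o, 'a) cat =
  Ob  :: "'o set"
  Arr :: "'a set"
  Dom :: "'a \<Rightarrow> 'o"
  Cod :: "'a \<Rightarrow> 'o"
  Idt :: "'o \<Rightarrow> 'a"
  Cmp :: "'a \<Rightarrow> 'a \<Rightarrow> 'a"  (infixr "\<odot>\<index>" 70)

locale category =
  fixes C :: "('o, 'a, 'z) cat_scheme" (structure)
  assumes Dom_Ob: "f \<in> Arr C \<Longrightarrow> Dom C f \<in> Ob C"
    and Cod_Ob: "f \<in> Arr C \<Longrightarrow> Cod C f \<in> Ob C"
    and Idt_Arr: "x \<in> Ob C \<Longrightarrow> Idt C x \<in> Arr C"
    and Dom_Idt: "x \<in> Ob C \<Longrightarrow> Dom C (Idt C x) = x"
    and Cod_Idt: "x \<in> Ob C \<Longrightarrow> Cod C (Idt C x) = x"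
    and Cmp_Arr: "\<lbrakk>f \<in> Arr C; g \<in> Arr C; Dom C g = Cod C f\<rbrakk> \<Longrightarrow> g \<odot> f \<in> Arr C"
    and Dom_Cmp: "\<lbrakk>f \<in> Arr C; g \<in> Arr C; Dom C g = Cod C f\<rbrakk> \<Longrightarrow> Dom C (g \<odot> f) = Dom C f"
    and Cod_Cmp: "\<lbrakk>f \<in> Arr C; g \<in> Arr C; Dom C g = Cod C f\<rbrakk> \<Longrightarrow> Cod C (g \<odot> f) = Cod C g"
    and Cmp_Idt_left: "f \<in> Arr C \<Longrightarrow> Idt C (Cod C f) \<odot> f = f"
    and Cmp_Idt_right: "f \<in> Arr C \<Longrightarrow> f \<odot> Idt C (Dom C f) = f"
    and Cmp_assoc: "\<lbrakk>f \<in> Arr C; g \<in> Arr C; h \<in> Arr C; Dom C g = Cod C f; Dom C h = Cod C g\<rbrakk>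
      \<Longrightarrow> (h \<odot> g) \<odot> f = h \<odot> (g \<odot> f)"

definition hom :: "('o, 'a, 'z) cat_scheme \<Rightarrow> 'o \<Rightarrow> 'o \<Rightarrow> 'a set" where
  "hom C x y = {f \<in> Arr C. Dom C f = x \<and> Cod C f = y}"

record ('o, 'a, 'p, 'b) ftor =
  onOb  :: "'o \<Rightarrow> 'p"
  onArr :: "'a \<Rightarrow> 'b"

definition is_functor ::
  "('o, 'a, 'y) cat_scheme \<Rightarrow> ('p, 'b, 'z) cat_scheme \<Rightarrow> ('o, 'a, 'p, 'b) ftor \<Rightarrow> bool" where
  "is_functor C D T \<longleftrightarrow>
     (\<forall>x\<in>Ob C. onOb T x \<in> Ob D) \<and>
     (\<forall>f\<in>Arr C. onArr T f \<in> hom D (onOb T (Dom C f)) (onOb T (Cod C f))) \<and>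
     (\<forall>x\<in>Ob C. onArr T (Idt C x) = Idt D (onOb T x)) \<and>
     (\<forall>f\<in>Arr C. \<forall>g\<in>Arr C. Dom C g = Cod C f \<longrightarrow>
        onArr T (g \<odot>\<^bsub>C\<^esub> f) = onArr T g \<odot>\<^bsub>D\<^esub> onArr T f)"

definition functor_comp ::
  "('p, 'b, 'q, 'c) ftor \<Rightarrow> ('o, 'a, 'p, 'b) ftor \<Rightarrow> ('o, 'a, 'q, 'c) ftor" where
  "functor_comp S T = \<lparr>onOb = onOb S \<circ> onOb T, onArr = onArr S \<circ> onArr T\<rparr>"

definition surjective_on_objects ::
  "('o, 'a, 'y) cat_scheme \<Rightarrow> ('p, 'b, 'z) cat_scheme \<Rightarrow> ('o, 'a, 'p, 'b) ftor \<Rightarrow> bool" where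
  "surjective_on_objects C D T \<longleftrightarrow> (\<forall>y\<in>Ob D. \<exists>x\<in>Ob C. onOb T x = y)"

definition isomorphism_of_categories ::
  "('o, 'a, 'y) cat_scheme \<Rightarrow> ('p, 'b, 'z) cat_scheme \<Rightarrow> ('o, 'a, 'p, 'b) ftor \<Rightarrow> bool" where
  "isomorphism_of_categories C D T \<longleftrightarrow> is_functor C D T \<and>
     (\<exists>S. is_functor D C S \<and>
        (\<forall>x\<in>Ob C. onOb S (onOb T x) = x) \<and> (\<forall>f\<in>Arr C. onArr S (onArr T f) = f) \<and>
        (\<forall>y\<in>Ob D. onOb T (onOb S y) = y) \<and> (\<forall>g\<in>Arr D. onArr T (onArr S g) = g))"

definition isomorphic_categories ::
  "('o, 'a, 'y) cat_scheme \<Rightarrow> ('p, 'b, 'z) cat_scheme \<Rightarrow> bool" where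
  "isomorphic_categories C D \<longleftrightarrow> (\<exists>T. isomorphism_of_categories C D T)"

definition terminal_cat :: "(unit, unit) cat" where
  "terminal_cat = \<lparr>Ob = {()}, Arr = {()}, Dom = (\<lambda>_. ()), Cod = (\<lambda>_. ()),
     Idt = (\<lambda>_. ()), Cmp = (\<lambda>_ _. ())\<rparr>"


section \<open>Strict 2-categories\<close>

text \<open>Vertical composition \<open>b \<bullet> a\<close> is ``first \<open>a\<close>, then \<open>b\<close>''; horizontal composition \<open>b \<star> a\<close>
  has source \<open>Src b \<odot> Src a\<close>. Whiskering is horizontal composition with an identity 2-cell.\<close>

record ('o, 'm, 'c) two_cat = "('o, 'm) cat" +
  Cell :: "'c set"
  Src  :: "'c \<Rightarrow> 'm"
  Tgt  :: "'c \<Rightarrow> 'm"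
  Idt2 :: "'m \<Rightarrow> 'c"
  VCmp :: "'c \<Rightarrow> 'c \<Rightarrow> 'c"  (infixr "\<bullet>\<index>" 65)
  HCmp :: "'c \<Rightarrow> 'c \<Rightarrow> 'c"  (infixr "\<star>\<index>" 70)

locale two_category = category C for C :: "('o, 'm, 'c, 'z) two_cat_scheme" (structure) +
  assumes Src_Arr: "a \<in> Cell C \<Longrightarrow> Src C a \<in> Arr C"
    and Tgt_Arr: "a \<in> Cell C \<Longrightarrow> Tgt C a \<in> Arr C"
    and Dom_Tgt: "a \<in> Cell C \<Longrightarrow> Dom C (Tgt C a) = Dom C (Src C a)"
    and Cod_Tgt: "a \<in> Cell C \<Longrightarrow> Cod C (Tgt C a) = Cod C (Src C a)"
    and Idt2_Cell: "f \<in> Arr C \<Longrightarrow> Idt2 C f \<in> Cell C"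
    and Src_Idt2: "f \<in> Arr C \<Longrightarrow> Src C (Idt2 C f) = f"
    and Tgt_Idt2: "f \<in> Arr C \<Longrightarrow> Tgt C (Idt2 C f) = f"
    and VCmp_Cell: "\<lbrakk>a \<in> Cell C; b \<in> Cell C; Src C b = Tgt C a\<rbrakk> \<Longrightarrow> b \<bullet> a \<in> Cell C"
    and Src_VCmp: "\<lbrakk>a \<in> Cell C; b \<in> Cell C; Src C b = Tgt C a\<rbrakk> \<Longrightarrow> Src C (b \<bullet> a) = Src C a"
    and Tgt_VCmp: "\<lbrakk>a \<in> Cell C; b \<in> Cell C; Src C b = Tgt C a\<rbrakk> \<Longrightarrow> Tgt C (b \<bullet> a) = Tgt C b"
    and VCmp_Idt2_left: "a \<in> Cell C \<Longrightarrow> Idt2 C (Tgt C a) \<bullet> a = a"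
    and VCmp_Idt2_right: "a \<in> Cell C \<Longrightarrow> a \<bullet> Idt2 C (Src C a) = a"
    and VCmp_assoc: "\<lbrakk>a \<in> Cell C; b \<in> Cell C; c \<in> Cell C; Src C b = Tgt C a; Src C c = Tgt C b\<rbrakk>
      \<Longrightarrow> (c \<bullet> b) \<bullet> a = c \<bullet> (b \<bullet> a)"
    and HCmp_Cell: "\<lbrakk>a \<in> Cell C; b \<in> Cell C; Dom C (Src C b) = Cod C (Src C a)\<rbrakk> \<Longrightarrow> b \<star> a \<in> Cell C"
    and Src_HCmp: "\<lbrakk>a \<in> Cell C; b \<in> Cell C; Dom C (Src C b) = Cod C (Src C a)\<rbrakk>
      \<Longrightarrow> Src C (b \<star> a) = Src C b \<odot> Src C a"
    and Tgt_HCmp: "\<lbrakk>a \<in> Cell C; b \<in> Cell C; Dom C (Src C b) = Cod C (Src C a)\<rbrakk>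
      \<Longrightarrow> Tgt C (b \<star> a) = Tgt C b \<odot> Tgt C a"
    and HCmp_Idt_left: "a \<in> Cell C \<Longrightarrow> Idt2 C (Idt C (Cod C (Src C a))) \<star> a = a"
    and HCmp_Idt_right: "a \<in> Cell C \<Longrightarrow> a \<star> Idt2 C (Idt C (Dom C (Src C a))) = a"
    and HCmp_assoc: "\<lbrakk>a \<in> Cell C; b \<in> Cell C; c \<in> Cell C;
        Dom C (Src C b) = Cod C (Src C a); Dom C (Src C c) = Cod C (Src C b)\<rbrakk>
      \<Longrightarrow> (c \<star> b) \<star> a = c \<star> (b \<star> a)"
    and HCmp_Idt2: "\<lbrakk>f \<in> Arr C; g \<in> Arr C; Dom C g = Cod C f\<rbrakk>
      \<Longrightarrow> Idt2 C g \<star> Idt2 C f = Idt2 C (g \<odot> f)"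
    and interchange: "\<lbrakk>a \<in> Cell C; a' \<in> Cell C; b \<in> Cell C; b' \<in> Cell C;
        Src C a' = Tgt C a; Src C b' = Tgt C b; Dom C (Src C b) = Cod C (Src C a)\<rbrakk>
      \<Longrightarrow> (b' \<bullet> b) \<star> (a' \<bullet> a) = (b' \<star> a') \<bullet> (b \<star> a)"

definition hom_cat :: "('o, 'm, 'c, 'z) two_cat_scheme \<Rightarrow> 'o \<Rightarrow> 'o \<Rightarrow> ('m, 'c) cat" where
  "hom_cat B x y = \<lparr>Ob = hom B x y, Arr = {a \<in> Cell B. Src B a \<in> hom B x y \<and> Tgt B a \<in> hom B x y},
     Dom = Src B, Cod = Tgt B, Idt = Idt2 B, Cmp = VCmp B\<rparr>"

definition two_terminal :: "('o, 'm, 'c, 'z) two_cat_scheme \<Rightarrow> 'o \<Rightarrow> bool" where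
  "two_terminal B L \<longleftrightarrow>
     L \<in> Ob B \<and> (\<forall>X\<in>Ob B. isomorphic_categories (hom_cat B X L) terminal_cat)"

text \<open>Post-composition with \<open>l : y \<rightarrow> z\<close>, as a functor \<open>B(x, y) \<rightarrow> B(x, z)\<close>.\<close>

definition post_comp :: "('o, 'm, 'c, 'z) two_cat_scheme \<Rightarrow> 'm \<Rightarrow> ('m, 'c, 'm, 'c) ftor" where
  "post_comp B l = \<lparr>onOb = (\<lambda>m. l \<odot>\<^bsub>B\<^esub> m), onArr = (\<lambda>a. Idt2 B l \<star>\<^bsub>B\<^esub> a)\<rparr>"


section \<open>2-functors, lax-natural transformations, modifications\<close>

text \<open>All component families below are extensional (equal to \<open>undefined\<close> outside the
  relevant carrier), so that equality of records is equality of 2-functors, lax-natural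
  transformations and modifications. Transformations and modifications carry
  their source and target.\<close>

record ('o, 'm, 'c, 'p, 'n, 'd) two_functor_data =
  F0 :: "'o \<Rightarrow> 'p"
  F1 :: "'m \<Rightarrow> 'n"
  F2 :: "'c \<Rightarrow> 'd"

definition two_functor ::
  "('o, 'm, 'c) two_cat \<Rightarrow> ('p, 'n, 'd) two_cat \<Rightarrow> ('o, 'm, 'c, 'p, 'n, 'd) two_functor_data \<Rightarrow> bool" where
  "two_functor I A F \<longleftrightarrow>
     F0 F \<in> Ob I \<rightarrow>\<^sub>E Ob A \<and> F1 F \<in> Arr I \<rightarrow>\<^sub>E Arr A \<and> F2 F \<in> Cell I \<rightarrow>\<^sub>E Cell A \<and>
     (\<forall>f\<in>Arr I. Dom A (F1 F f) = F0 F (Dom I f) \<and> Cod A (F1 F f) = F0 F (Cod I f)) \<and>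
     (\<forall>a\<in>Cell I. Src A (F2 F a) = F1 F (Src I a) \<and> Tgt A (F2 F a) = F1 F (Tgt I a)) \<and>
     (\<forall>i\<in>Ob I. F1 F (Idt I i) = Idt A (F0 F i)) \<and>
     (\<forall>f\<in>Arr I. \<forall>g\<in>Arr I. Dom I g = Cod I f \<longrightarrow> F1 F (g \<odot>\<^bsub>I\<^esub> f) = F1 F g \<odot>\<^bsub>A\<^esub> F1 F f) \<and>
     (\<forall>f\<in>Arr I. F2 F (Idt2 I f) = Idt2 A (F1 F f)) \<and>
     (\<forall>a\<in>Cell I. \<forall>b\<in>Cell I. Src I b = Tgt I a \<longrightarrow> F2 F (b \<bullet>\<^bsub>I\<^esub> a) = F2 F b \<bullet>\<^bsub>A\<^esub> F2 F a) \<and>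
     (\<forall>a\<in>Cell I. \<forall>b\<in>Cell I. Dom I (Src I b) = Cod I (Src I a) \<longrightarrow>
        F2 F (b \<star>\<^bsub>I\<^esub> a) = F2 F b \<star>\<^bsub>A\<^esub> F2 F a)"

record ('o, 'm, 'c, 'p, 'n, 'd) trans =
  TSrc :: "('o, 'm, 'c, 'p, 'n, 'd) two_functor_data"
  TTgt :: "('o, 'm, 'c, 'p, 'n, 'd) two_functor_data"
  T1 :: "'o \<Rightarrow> 'n"
  T2 :: "'m \<Rightarrow> 'd"

definition lax_natural ::
  "('o, 'm, 'c) two_cat \<Rightarrow> ('p, 'n, 'd) two_cat \<Rightarrow> ('o, 'm, 'c, 'p, 'n, 'd) trans \<Rightarrow> bool" where
  "lax_natural I A \<mu> \<longleftrightarrow> (let F = TSrc \<mu>; G = TTgt \<mu> in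
     two_functor I A F \<and> two_functor I A G \<and>
     T1 \<mu> \<in> Ob I \<rightarrow>\<^sub>E Arr A \<and> T2 \<mu> \<in> Arr I \<rightarrow>\<^sub>E Cell A \<and>
     (\<forall>i\<in>Ob I. T1 \<mu> i \<in> hom A (F0 F i) (F0 G i)) \<and>
     (\<forall>f\<in>Arr I. Src A (T2 \<mu> f) = F1 G f \<odot>\<^bsub>A\<^esub> T1 \<mu> (Dom I f) \<and>
                Tgt A (T2 \<mu> f) = T1 \<mu> (Cod I f) \<odot>\<^bsub>A\<^esub> F1 F f) \<and>
     (\<forall>i\<in>Ob I. T2 \<mu> (Idt I i) = Idt2 A (T1 \<mu> i)) \<and>
     (\<forall>f\<in>Arr I. \<forall>g\<in>Arr I. Dom I g = Cod I f \<longrightarrow>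
        T2 \<mu> (g \<odot>\<^bsub>I\<^esub> f) =
          (T2 \<mu> g \<star>\<^bsub>A\<^esub> Idt2 A (F1 F f)) \<bullet>\<^bsub>A\<^esub> (Idt2 A (F1 G g) \<star>\<^bsub>A\<^esub> T2 \<mu> f)) \<and>
     (\<forall>\<alpha>\<in>Cell I. let f = Src I \<alpha>; g = Tgt I \<alpha>; i = Dom I f; j = Cod I f in
        T2 \<mu> g \<bullet>\<^bsub>A\<^esub> (F2 G \<alpha> \<star>\<^bsub>A\<^esub> Idt2 A (T1 \<mu> i)) =
          (Idt2 A (T1 \<mu> j) \<star>\<^bsub>A\<^esub> F2 F \<alpha>) \<bullet>\<^bsub>A\<^esub> T2 \<mu> f))"

record ('o, 'm, 'c, 'p, 'n, 'd) modif =
  MSrc :: "('o, 'm, 'c, 'p, 'n, 'd) trans"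
  MTgt :: "('o, 'm, 'c, 'p, 'n, 'd) trans"
  Mcomp :: "'o \<Rightarrow> 'd"

definition modification ::
  "('o, 'm, 'c) two_cat \<Rightarrow> ('p, 'n, 'd) two_cat \<Rightarrow> ('o, 'm, 'c, 'p, 'n, 'd) modif \<Rightarrow> bool" where
  "modification I A \<phi> \<longleftrightarrow> (let \<mu> = MSrc \<phi>; \<nu> = MTgt \<phi>; F = TSrc \<mu>; G = TTgt \<mu> in
     lax_natural I A \<mu> \<and> lax_natural I A \<nu> \<and> TSrc \<nu> = F \<and> TTgt \<nu> = G \<and>
     Mcomp \<phi> \<in> Ob I \<rightarrow>\<^sub>E Cell A \<and>
     (\<forall>i\<in>Ob I. Src A (Mcomp \<phi> i) = T1 \<mu> i \<and> Tgt A (Mcomp \<phi> i) = T1 \<nu> i) \<and>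
     (\<forall>f\<in>Arr I. let i = Dom I f; j = Cod I f in
        T2 \<nu> f \<bullet>\<^bsub>A\<^esub> (Idt2 A (F1 G f) \<star>\<^bsub>A\<^esub> Mcomp \<phi> i) =
          (Mcomp \<phi> j \<star>\<^bsub>A\<^esub> Idt2 A (F1 F f)) \<bullet>\<^bsub>A\<^esub> T2 \<mu> f))"

text \<open>In the composite \<open>\<nu>\<mu> : F \<Rightarrow> G \<Rightarrow> H\<close> the 2-cell at \<open>f : i \<rightarrow> j\<close> is the pasting
  \<open>(Hf)\<nu>\<^sub>i\<mu>\<^sub>i \<Rightarrow> \<nu>\<^sub>j(Gf)\<mu>\<^sub>i \<Rightarrow> \<nu>\<^sub>j\<mu>\<^sub>j(Ff)\<close>.\<close>

definition Lax ::
  "('o, 'm, 'c) two_cat \<Rightarrow> ('p, 'n, 'd) two_cat \<Rightarrow>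
   (('o, 'm, 'c, 'p, 'n, 'd) two_functor_data, ('o, 'm, 'c, 'p, 'n, 'd) trans,
    ('o, 'm, 'c, 'p, 'n, 'd) modif) two_cat" where
  "Lax I A =
    (let comp = (\<lambda>\<nu> \<mu>. \<lparr>TSrc = TSrc \<mu>, TTgt = TTgt \<nu>,
           T1 = (\<lambda>i\<in>Ob I. T1 \<nu> i \<odot>\<^bsub>A\<^esub> T1 \<mu> i),
           T2 = (\<lambda>f\<in>Arr I. (Idt2 A (T1 \<nu> (Cod I f)) \<star>\<^bsub>A\<^esub> T2 \<mu> f) \<bullet>\<^bsub>A\<^esub>
                            (T2 \<nu> f \<star>\<^bsub>A\<^esub> Idt2 A (T1 \<mu> (Dom I f))))\<rparr>)
     in \<lparr>Ob = {F. two_functor I A F},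
         Arr = {\<mu>. lax_natural I A \<mu>},
         Dom = TSrc, Cod = TTgt,
         Idt = (\<lambda>F. \<lparr>TSrc = F, TTgt = F, T1 = (\<lambda>i\<in>Ob I. Idt A (F0 F i)),
                     T2 = (\<lambda>f\<in>Arr I. Idt2 A (F1 F f))\<rparr>),
         Cmp = comp,
         Cell = {\<phi>. modification I A \<phi>},
         Src = MSrc, Tgt = MTgt,
         Idt2 = (\<lambda>\<mu>. \<lparr>MSrc = \<mu>, MTgt = \<mu>, Mcomp = (\<lambda>i\<in>Ob I. Idt2 A (T1 \<mu> i))\<rparr>),
         VCmp = (\<lambda>\<psi> \<phi>. \<lparr>MSrc = MSrc \<phi>, MTgt = MTgt \<psi>,
                        Mcomp = (\<lambda>i\<in>Ob I. Mcomp \<psi> i \<bullet>\<^bsub>A\<^esub> Mcomp \<phi> i)\<rparr>),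
         HCmp = (\<lambda>\<psi> \<phi>. \<lparr>MSrc = comp (MSrc \<psi>) (MSrc \<phi>), MTgt = comp (MTgt \<psi>) (MTgt \<phi>),
                        Mcomp = (\<lambda>i\<in>Ob I. Mcomp \<psi> i \<star>\<^bsub>A\<^esub> Mcomp \<phi> i)\<rparr>)\<rparr>)"


section \<open>Lax-cones, lax-limits, the lax-slice\<close>

definition Delta0 ::
  "('o, 'm, 'c) two_cat \<Rightarrow> ('p, 'n, 'd) two_cat \<Rightarrow> 'p \<Rightarrow> ('o, 'm, 'c, 'p, 'n, 'd) two_functor_data" where
  "Delta0 I A X = \<lparr>F0 = (\<lambda>i\<in>Ob I. X), F1 = (\<lambda>f\<in>Arr I. Idt A X),
     F2 = (\<lambda>a\<in>Cell I. Idt2 A (Idt A X))\<rparr>"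

definition Delta1 ::
  "('o, 'm, 'c) two_cat \<Rightarrow> ('p, 'n, 'd) two_cat \<Rightarrow> 'n \<Rightarrow> ('o, 'm, 'c, 'p, 'n, 'd) trans" where
  "Delta1 I A h = \<lparr>TSrc = Delta0 I A (Dom A h), TTgt = Delta0 I A (Cod A h),
     T1 = (\<lambda>i\<in>Ob I. h), T2 = (\<lambda>f\<in>Arr I. Idt2 A h)\<rparr>"

definition Delta2 ::
  "('o, 'm, 'c) two_cat \<Rightarrow> ('p, 'n, 'd) two_cat \<Rightarrow> 'd \<Rightarrow> ('o, 'm, 'c, 'p, 'n, 'd) modif" where
  "Delta2 I A \<beta> = \<lparr>MSrc = Delta1 I A (Src A \<beta>), MTgt = Delta1 I A (Tgt A \<beta>),
     Mcomp = (\<lambda>i\<in>Ob I. \<beta>)\<rparr>"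

text \<open>The functor \<open>A(X, Y) \<rightarrow> Lax[I, A](\<Delta>X, \<Delta>Y)\<close>.\<close>

definition Delta ::
  "('o, 'm, 'c) two_cat \<Rightarrow> ('p, 'n, 'd) two_cat \<Rightarrow>
   ('n, 'd, ('o, 'm, 'c, 'p, 'n, 'd) trans, ('o, 'm, 'c, 'p, 'n, 'd) modif) ftor" where
  "Delta I A = \<lparr>onOb = Delta1 I A, onArr = Delta2 I A\<rparr>"

definition lax_cones ::
  "('o, 'm, 'c) two_cat \<Rightarrow> ('p, 'n, 'd) two_cat \<Rightarrow> ('o, 'm, 'c, 'p, 'n, 'd) two_functor_data \<Rightarrow>
   'p \<Rightarrow> ('o, 'm, 'c, 'p, 'n, 'd) trans set" where
  "lax_cones I A F X = hom (Lax I A) (Delta0 I A X) F"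

definition cone_functor ::
  "('o, 'm, 'c) two_cat \<Rightarrow> ('p, 'n, 'd) two_cat \<Rightarrow> ('o, 'm, 'c, 'p, 'n, 'd) trans \<Rightarrow>
   ('n, 'd, ('o, 'm, 'c, 'p, 'n, 'd) trans, ('o, 'm, 'c, 'p, 'n, 'd) modif) ftor" where
  "cone_functor I A \<kappa> = functor_comp (post_comp (Lax I A) \<kappa>) (Delta I A)"

definition lax_limit ::
  "('o, 'm, 'c) two_cat \<Rightarrow> ('p, 'n, 'd) two_cat \<Rightarrow> ('o, 'm, 'c, 'p, 'n, 'd) two_functor_data \<Rightarrow>
   'p \<times> ('o, 'm, 'c, 'p, 'n, 'd) trans \<Rightarrow> bool" where
  "lax_limit I A F = (\<lambda>(L, \<kappa>). L \<in> Ob A \<and> \<kappa> \<in> lax_cones I A F L \<and>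
     (\<forall>X\<in>Ob A. isomorphism_of_categories (hom_cat A X L) (hom_cat (Lax I A) (Delta0 I A X) F)
        (cone_functor I A \<kappa>)))"

text \<open>Morphisms \<open>((X, \<mu>), (h, \<phi>), (Y, \<nu>))\<close> of the lax-slice carry their domain and codomain,
  2-morphisms \<open>(s, \<beta>, t)\<close> their source and target. For composable \<open>(h, \<phi>)\<close> and
  \<open>(k, \<psi>)\<close>, the modification of the composite is \<open>\<rho>\<Delta>k\<Delta>h \<rightarrow> \<nu>\<Delta>h \<rightarrow> \<mu>\<close>.\<close>

definition lax_slice ::
  "('o, 'm, 'c) two_cat \<Rightarrow> ('p, 'n, 'd) two_cat \<Rightarrow> ('o, 'm, 'c, 'p, 'n, 'd) two_functor_data \<Rightarrow>
   ('p \<times> ('o, 'm, 'c, 'p, 'n, 'd) trans,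
    ('p \<times> ('o, 'm, 'c, 'p, 'n, 'd) trans) \<times> ('n \<times> ('o, 'm, 'c, 'p, 'n, 'd) modif) \<times>
      ('p \<times> ('o, 'm, 'c, 'p, 'n, 'd) trans),
    (('p \<times> ('o, 'm, 'c, 'p, 'n, 'd) trans) \<times> ('n \<times> ('o, 'm, 'c, 'p, 'n, 'd) modif) \<times>
      ('p \<times> ('o, 'm, 'c, 'p, 'n, 'd) trans)) \<times> 'd \<times>
    (('p \<times> ('o, 'm, 'c, 'p, 'n, 'd) trans) \<times> ('n \<times> ('o, 'm, 'c, 'p, 'n, 'd) modif) \<times>
      ('p \<times> ('o, 'm, 'c, 'p, 'n, 'd) trans))) two_cat" where
  "lax_slice I A F =
    (let L = Lax I A;
         obs = {(X, \<mu>). X \<in> Ob A \<and> \<mu> \<in> lax_cones I A F X};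
         arrs = {((X, \<mu>), (h, \<phi>), (Y, \<nu>)) | X \<mu> h \<phi> Y \<nu>.
                   (X, \<mu>) \<in> obs \<and> (Y, \<nu>) \<in> obs \<and> h \<in> hom A X Y \<and>
                   \<phi> \<in> Cell L \<and> Src L \<phi> = \<nu> \<odot>\<^bsub>L\<^esub> Delta1 I A h \<and> Tgt L \<phi> = \<mu>};
         comp = (\<lambda>(_, (k, \<psi>), R) (P, (h, \<phi>), _).
                   (P, (k \<odot>\<^bsub>A\<^esub> h, \<phi> \<bullet>\<^bsub>L\<^esub> (\<psi> \<star>\<^bsub>L\<^esub> Idt2 L (Delta1 I A h))), R))
     in \<lparr>Ob = obs,
         Arr = arrs,
         Dom = (\<lambda>(P, _, _). P), Cod = (\<lambda>(_, _, Q). Q),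
         Idt = (\<lambda>(X, \<mu>). ((X, \<mu>), (Idt A X, Idt2 L \<mu>), (X, \<mu>))),
         Cmp = comp,
         Cell = {((P, (h, \<phi>), (Y, \<nu>)), \<beta>, (P, (k, \<psi>), (Y, \<nu>))) | P h \<phi> Y \<nu> \<beta> k \<psi>.
                   (P, (h, \<phi>), (Y, \<nu>)) \<in> arrs \<and> (P, (k, \<psi>), (Y, \<nu>)) \<in> arrs \<and>
                   \<beta> \<in> Cell A \<and> Src A \<beta> = h \<and> Tgt A \<beta> = k \<and>
                   \<psi> \<bullet>\<^bsub>L\<^esub> (Idt2 L \<nu> \<star>\<^bsub>L\<^esub> Delta2 I A \<beta>) = \<phi>},
         Src = (\<lambda>(s, _, _). s), Tgt = (\<lambda>(_, _, t). t),
         Idt2 = (\<lambda>(P, (h, \<phi>), Q). ((P, (h, \<phi>), Q), Idt2 A h, (P, (h, \<phi>), Q))),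
         VCmp = (\<lambda>(_, \<gamma>, u) (s, \<beta>, _). (s, \<gamma> \<bullet>\<^bsub>A\<^esub> \<beta>, u)),
         HCmp = (\<lambda>(s', \<gamma>, t') (s, \<beta>, t). (comp s' s, \<gamma> \<star>\<^bsub>A\<^esub> \<beta>, comp t' t))\<rparr>)"


section \<open>2-functors out of the arrow category\<close>

text \<open>The category \<open>{0 \<rightarrow> 1}\<close> with only identity 2-morphisms: a morphism is a pair \<open>(i, j)\<close> with
  \<open>i \<le> j \<le> 1\<close>, and each morphism serves as its own identity 2-morphism.\<close>

definition Two :: "(nat, nat \<times> nat, nat \<times> nat) two_cat" where
  "Two = \<lparr>Ob = {0, 1}, Arr = {(0, 0), (0, 1), (1, 1)}, Dom = fst, Cod = snd,
     Idt = (\<lambda>i. (i, i)), Cmp = (\<lambda>g f. (fst f, snd g)),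
     Cell = {(0, 0), (0, 1), (1, 1)}, Src = id, Tgt = id, Idt2 = id,
     VCmp = (\<lambda>b a. a), HCmp = (\<lambda>b a. (fst a, snd b))\<rparr>"

definition arrow_functor ::
  "('p, 'n, 'd) two_cat \<Rightarrow> 'n \<Rightarrow> (nat, nat \<times> nat, nat \<times> nat, 'p, 'n, 'd) two_functor_data" where
  "arrow_functor A f =
    (let m = (\<lambda>p. if p = (0, 0) then Idt A (Dom A f) else if p = (0, 1) then f else Idt A (Cod A f))
     in \<lparr>F0 = (\<lambda>i\<in>Ob Two. if i = 0 then Dom A f else Cod A f),
         F1 = (\<lambda>p\<in>Arr Two. m p),
         F2 = (\<lambda>p\<in>Cell Two. Idt2 A (m p))\<rparr>)"

text \<open>The 2-cell components at the identities of \<open>0\<close> and \<open>1\<close> are forced by the unit axiom.\<close>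

definition id_cone ::
  "('p, 'n, 'd) two_cat \<Rightarrow> 'n \<Rightarrow> (nat, nat \<times> nat, nat \<times> nat, 'p, 'n, 'd) trans" where
  "id_cone A f = \<lparr>TSrc = Delta0 Two A (Dom A f), TTgt = arrow_functor A f,
     T1 = (\<lambda>i\<in>Ob Two. if i = 0 then Idt A (Dom A f) else f),
     T2 = (\<lambda>p\<in>Arr Two. if p = (0, 0) then Idt2 A (Idt A (Dom A f)) else Idt2 A f)\<rparr>"


section \<open>Freely generated 2-categories\<close>

text \<open>A 1-cell of the free 2-category is a path \<open>(x, gs, y)\<close> from \<open>x\<close> to \<open>y\<close>, with the generators
  \<open>gs\<close> listed in the order in which they are traversed. A 2-cell is a formal
  composite of generating and identity 2-cells, modulo the least congruence containing the
  axioms of a 2-category.\<close>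

type_synonym ('o, 'g) path = "'o \<times> 'g list \<times> 'o"

record ('o, 'g, 'e) computad =
  GOb  :: "'o set"
  GArr :: "'g set"
  GDom :: "'g \<Rightarrow> 'o"
  GCod :: "'g \<Rightarrow> 'o"
  GCell :: "'e set"
  GSrc :: "'e \<Rightarrow> ('o, 'g) path"
  GTgt :: "'e \<Rightarrow> ('o, 'g) path"

inductive_set paths :: "('o, 'g, 'e) computad \<Rightarrow> ('o, 'g) path set" for G where
  empty: "x \<in> GOb G \<Longrightarrow> (x, [], x) \<in> paths G"
| step: "g \<in> GArr G \<Longrightarrow> GDom G g = x \<Longrightarrow> x \<in> GOb G \<Longrightarrow> (GCod G g, gs, y) \<in> paths G
    \<Longrightarrow> (x, g # gs, y) \<in> paths G"

fun psrc :: "('o, 'g) path \<Rightarrow> 'o" where "psrc (x, gs, y) = x"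
fun ptgt :: "('o, 'g) path \<Rightarrow> 'o" where "ptgt (x, gs, y) = y"
fun pcomp :: "('o, 'g) path \<Rightarrow> ('o, 'g) path \<Rightarrow> ('o, 'g) path" where
  "pcomp (y', hs, z) (x, gs, y) = (x, gs @ hs, z)"

definition well_formed_computad :: "('o, 'g, 'e) computad \<Rightarrow> bool" where
  "well_formed_computad G \<longleftrightarrow>
     (\<forall>g\<in>GArr G. GDom G g \<in> GOb G \<and> GCod G g \<in> GOb G) \<and>
     (\<forall>c\<in>GCell G. GSrc G c \<in> paths G \<and> GTgt G c \<in> paths G \<and>
        psrc (GSrc G c) = psrc (GTgt G c) \<and> ptgt (GSrc G c) = ptgt (GTgt G c))"

datatype ('o, 'g, 'e) cell_term =
    IdT "('o, 'g) path"
  | GenT 'e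
  | VT "('o, 'g, 'e) cell_term" "('o, 'g, 'e) cell_term"
  | HT "('o, 'g, 'e) cell_term" "('o, 'g, 'e) cell_term"

inductive typed ::
  "('o, 'g, 'e) computad \<Rightarrow> ('o, 'g, 'e) cell_term \<Rightarrow> ('o, 'g) path \<Rightarrow> ('o, 'g) path \<Rightarrow> bool"
  for G where
  IdT: "p \<in> paths G \<Longrightarrow> typed G (IdT p) p p"
| GenT: "c \<in> GCell G \<Longrightarrow> typed G (GenT c) (GSrc G c) (GTgt G c)"
| VT: "typed G a p q \<Longrightarrow> typed G b q r \<Longrightarrow> typed G (VT b a) p r"
| HT: "typed G a p q \<Longrightarrow> typed G b p' q' \<Longrightarrow> psrc p' = ptgt p
    \<Longrightarrow> typed G (HT b a) (pcomp p' p) (pcomp q' q)"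

inductive term_eq ::
  "('o, 'g, 'e) computad \<Rightarrow> ('o, 'g, 'e) cell_term \<Rightarrow> ('o, 'g, 'e) cell_term \<Rightarrow> bool"
  for G where
  refl: "typed G a p q \<Longrightarrow> term_eq G a a"
| sym: "term_eq G a b \<Longrightarrow> term_eq G b a"
| trans: "term_eq G a b \<Longrightarrow> term_eq G b c \<Longrightarrow> term_eq G a c"
| VT_cong: "typed G a p q \<Longrightarrow> typed G b q r \<Longrightarrow> term_eq G a a' \<Longrightarrow> term_eq G b b'
    \<Longrightarrow> term_eq G (VT b a) (VT b' a')"
| HT_cong: "typed G a p q \<Longrightarrow> typed G b p' q' \<Longrightarrow> psrc p' = ptgt p \<Longrightarrow> term_eq G a a' \<Longrightarrow> term_eq G b b'
    \<Longrightarrow> term_eq G (HT b a) (HT b' a')"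
| VT_unit_left: "typed G a p q \<Longrightarrow> term_eq G (VT (IdT q) a) a"
| VT_unit_right: "typed G a p q \<Longrightarrow> term_eq G (VT a (IdT p)) a"
| VT_assoc: "typed G a p q \<Longrightarrow> typed G b q r \<Longrightarrow> typed G c r s
    \<Longrightarrow> term_eq G (VT (VT c b) a) (VT c (VT b a))"
| HT_unit_left: "typed G a p q \<Longrightarrow> term_eq G (HT (IdT (ptgt p, [], ptgt p)) a) a"
| HT_unit_right: "typed G a p q \<Longrightarrow> term_eq G (HT a (IdT (psrc p, [], psrc p))) a"
| HT_assoc: "typed G a p q \<Longrightarrow> typed G b p' q' \<Longrightarrow> typed G c p'' q''
    \<Longrightarrow> psrc p' = ptgt p \<Longrightarrow> psrc p'' = ptgt p'
    \<Longrightarrow> term_eq G (HT (HT c b) a) (HT c (HT b a))"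
| HT_IdT: "p \<in> paths G \<Longrightarrow> p' \<in> paths G \<Longrightarrow> psrc p' = ptgt p
    \<Longrightarrow> term_eq G (HT (IdT p') (IdT p)) (IdT (pcomp p' p))"
| interchange: "typed G a p q \<Longrightarrow> typed G a' q r \<Longrightarrow> typed G b p' q' \<Longrightarrow> typed G b' q' r'
    \<Longrightarrow> psrc p' = ptgt p
    \<Longrightarrow> term_eq G (HT (VT b' b) (VT a' a)) (VT (HT b' a') (HT b a))"

definition term_class ::
  "('o, 'g, 'e) computad \<Rightarrow> ('o, 'g, 'e) cell_term \<Rightarrow> ('o, 'g, 'e) cell_term set" where
  "term_class G a = {b. term_eq G a b}"

definition free_two_cat ::
  "('o, 'g, 'e) computad \<Rightarrow>
   ('o, ('o, 'g) path, ('o, 'g) path \<times> ('o, 'g, 'e) cell_term set \<times> ('o, 'g) path) two_cat" where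
  "free_two_cat G =
    \<lparr>Ob = GOb G, Arr = paths G, Dom = psrc, Cod = ptgt,
     Idt = (\<lambda>x. (x, [], x)), Cmp = pcomp,
     Cell = {(p, term_class G a, q) | p a q. typed G a p q},
     Src = (\<lambda>(p, _, _). p), Tgt = (\<lambda>(_, _, q). q),
     Idt2 = (\<lambda>p. (p, term_class G (IdT p), p)),
     VCmp = (\<lambda>(_, T, r) (p, S, _). (p, (\<Union>b\<in>T. \<Union>a\<in>S. term_class G (VT b a)), r)),
     HCmp = (\<lambda>(p', T, q') (p, S, q).
       (pcomp p' p, (\<Union>b\<in>T. \<Union>a\<in>S. term_class G (HT b a)), pcomp q' q))\<rparr>"


section \<open>The generating data\<close>

datatype gen_ob = ObX | ObA | ObB
datatype gen_arr = Alpha0 | Alpha1 | Eff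
datatype gen_cell = Alpha

definition example_computad :: "(gen_ob, gen_arr, gen_cell) computad" where
  "example_computad =
    \<lparr>GOb = UNIV, GArr = UNIV,
     GDom = (\<lambda>g. case g of Alpha0 \<Rightarrow> ObX | Alpha1 \<Rightarrow> ObX | Eff \<Rightarrow> ObA),
     GCod = (\<lambda>g. case g of Alpha0 \<Rightarrow> ObA | Alpha1 \<Rightarrow> ObB | Eff \<Rightarrow> ObB),
     GCell = UNIV,
     GSrc = (\<lambda>_. (ObX, [Alpha0, Eff], ObB)),
     GTgt = (\<lambda>_. (ObX, [Alpha1], ObB))\<rparr>"

abbreviation exA ::
  "(gen_ob, (gen_ob, gen_arr) path,
    (gen_ob, gen_arr) path \<times> (gen_ob, gen_arr, gen_cell) cell_term set \<times> (gen_ob, gen_arr) path) two_cat" where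
  "exA \<equiv> free_two_cat example_computad"

abbreviation exf :: "(gen_ob, gen_arr) path" where
  "exf \<equiv> (ObA, [Eff], ObB)"


section \<open>Well-formedness of the constructions\<close>

lemma paths_ends: "p \<in> paths G \<Longrightarrow> psrc p \<in> GOb G \<and> ptgt p \<in> GOb G"
proof -
  have "x \<in> GOb G \<and> y \<in> GOb G" if "(x, gs, y) \<in> paths G" for x gs y
    using that by (induction rule: paths.induct) auto
  then show "p \<in> paths G \<Longrightarrow> psrc p \<in> GOb G \<and> ptgt p \<in> GOb G"
    by (cases p) auto
qed

lemma paths_append:
  "(x, gs, y) \<in> paths G \<Longrightarrow> (y, hs, z) \<in> paths G \<Longrightarrow> (x, gs @ hs, z) \<in> paths G"
  by (induction x gs y rule: paths.induct) (auto intro: paths.step)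

lemma pcomp_paths:
  "p \<in> paths G \<Longrightarrow> q \<in> paths G \<Longrightarrow> psrc q = ptgt p \<Longrightarrow> pcomp q p \<in> paths G"
  by (cases p; cases q) (auto intro: paths_append)

lemma pcomp_ends [simp]: "psrc (pcomp q p) = psrc p" "ptgt (pcomp q p) = ptgt q"
  by (cases p; cases q; simp)+

lemma pcomp_unit: "pcomp (ptgt p, [], ptgt p) p = p" "pcomp p (psrc p, [], psrc p) = p"
  by (cases p; simp)+

lemma pcomp_assoc: "pcomp (pcomp r q) p = pcomp r (pcomp q p)"
  by (cases p; cases q; cases r) simp

lemma typed_paths:
  assumes "well_formed_computad G"
  shows "typed G a p q \<Longrightarrow> p \<in> paths G \<and> q \<in> paths G \<and> psrc q = psrc p \<and> ptgt q = ptgt p"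
  by (induction rule: typed.induct)
    (use assms in \<open>auto simp: well_formed_computad_def intro: pcomp_paths\<close>)

lemma typed_unique: "typed G a p q \<Longrightarrow> typed G a p' q' \<Longrightarrow> p' = p \<and> q' = q"
proof (induction arbitrary: p' q' rule: typed.induct)
  case (IdT p) from IdT(2) show ?case by cases auto
next
  case (GenT c) from GenT(2) show ?case by cases auto
next
  case (VT a p q b r) from VT(5) show ?case by cases (use VT(3,4) in blast)
next
  case (HT a p q b p1 q1) from HT(6) show ?case by cases (auto dest!: HT.IH)
qed

lemma term_eq_typed:
  assumes G: "well_formed_computad G"
  shows "term_eq G a b \<Longrightarrow> \<exists>p q. typed G a p q \<and> typed G b p q"
proof (induction rule: term_eq.induct)
  case (refl a p q) then show ?case by blast
next
  case (sym a b) then show ?case by blast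
next
  case (trans a b c)
  then obtain p q p' q' where "typed G a p q" "typed G b p q" "typed G b p' q'" "typed G c p' q'"
    by auto
  then show ?case using typed_unique[of G b p q p' q'] by blast
next
  case (VT_cong a p q b r a' b')
  have "typed G a' p q" using VT_cong.IH(1) typed_unique[OF VT_cong.hyps(1)] by blast
  moreover have "typed G b' q r" using VT_cong.IH(2) typed_unique[OF VT_cong.hyps(2)] by blast
  ultimately show ?case using typed.VT VT_cong.hyps by blast
next
  case (HT_cong a p q b p' q' a' b')
  have "typed G a' p q" using HT_cong.IH(1) typed_unique[OF HT_cong.hyps(1)] by blast
  moreover have "typed G b' p' q'" using HT_cong.IH(2) typed_unique[OF HT_cong.hyps(2)] by blast
  ultimately show ?case using typed.HT HT_cong.hyps by blast
next
  case (VT_unit_left a p q)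
  then show ?case using typed.VT[OF _ typed.IdT, of G a p q] typed_paths[OF G] by blast
next
  case (VT_unit_right a p q)
  then show ?case using typed.VT[OF typed.IdT, of p G a q] typed_paths[OF G] by blast
next
  case (VT_assoc a p q b r c s)
  then show ?case using typed.VT[OF typed.VT, of G a p q b r c s] typed.VT[OF _ typed.VT, of G a p q b r c s]
    by blast
next
  case (HT_unit_left a p q)
  note e = typed_paths[OF G HT_unit_left]
  have "typed G (IdT (ptgt p, [], ptgt p)) (ptgt p, [], ptgt p) (ptgt p, [], ptgt p)"
    using e paths_ends by (blast intro: typed.IdT paths.empty)
  from typed.HT[OF HT_unit_left this] have "typed G (HT (IdT (ptgt p, [], ptgt p)) a) p q"
    using e pcomp_unit(1)[of p] pcomp_unit(1)[of q] by simp
  then show ?case using HT_unit_left by blast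
next
  case (HT_unit_right a p q)
  note e = typed_paths[OF G HT_unit_right]
  have "typed G (IdT (psrc p, [], psrc p)) (psrc p, [], psrc p) (psrc p, [], psrc p)"
    using e paths_ends by (blast intro: typed.IdT paths.empty)
  from typed.HT[OF this HT_unit_right] have "typed G (HT a (IdT (psrc p, [], psrc p))) p q"
    using e pcomp_unit(2)[of p] pcomp_unit(2)[of q] by simp
  then show ?case using HT_unit_right by blast
next
  case (HT_assoc a p q b p' q' c p'' q'')
  note ba = typed.HT[OF HT_assoc(1,2,4)] and cb = typed.HT[OF HT_assoc(2,3,5)]
  have "typed G (HT (HT c b) a) (pcomp (pcomp p'' p') p) (pcomp (pcomp q'' q') q)"
    by (rule typed.HT[OF HT_assoc(1) cb]) (simp add: HT_assoc)
  moreover have "typed G (HT c (HT b a)) (pcomp p'' (pcomp p' p)) (pcomp q'' (pcomp q' q))"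
    by (rule typed.HT[OF ba HT_assoc(3)]) (simp add: HT_assoc)
  ultimately show ?case unfolding pcomp_assoc by blast
next
  case (HT_IdT p p')
  then show ?case using typed.HT[OF typed.IdT typed.IdT, of p G p'] typed.IdT[OF pcomp_paths, of p G p']
    by blast
next
  case (interchange a p q a' r b p' q' b' r')
  have "psrc q' = ptgt q" using interchange(5) typed_paths[OF G interchange(1)]
      typed_paths[OF G interchange(3)] by simp
  then show ?case
    using typed.HT[OF typed.VT[OF interchange(1,2)] typed.VT[OF interchange(3,4)] interchange(5)]
      typed.VT[OF typed.HT[OF interchange(1,3,5)] typed.HT[OF interchange(2,4)]] by blast
qed

lemma term_class_eq:
  "term_eq G a b \<Longrightarrow> term_class G a = term_class G b"
  unfolding term_class_def by (auto intro: term_eq.trans term_eq.sym)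

lemma VT_class:
  assumes "well_formed_computad G" "typed G a p q" "typed G b q r"
  shows "(\<Union>b'\<in>term_class G b. \<Union>a'\<in>term_class G a. term_class G (VT b' a')) = term_class G (VT b a)"
proof -
  have "term_class G (VT b' a') = term_class G (VT b a)"
    if "b' \<in> term_class G b" "a' \<in> term_class G a" for a' b'
    using term_class_eq[OF term_eq.VT_cong[OF assms(2,3)]] that
    unfolding term_class_def[of G a] term_class_def[of G b] by simp
  moreover have "a \<in> term_class G a" "b \<in> term_class G b"
    using assms by (auto simp: term_class_def intro: term_eq.refl)
  ultimately show ?thesis by blast
qed

lemma HT_class:
  assumes "well_formed_computad G" "typed G a p q" "typed G b p' q'" "psrc p' = ptgt p"
  shows "(\<Union>b'\<in>term_class G b. \<Union>a'\<in>term_class G a. term_class G (HT b' a')) = term_class G (HT b a)"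
proof -
  have "term_class G (HT b' a') = term_class G (HT b a)"
    if "b' \<in> term_class G b" "a' \<in> term_class G a" for a' b'
    using term_class_eq[OF term_eq.HT_cong[OF assms(2,3,4)]] that
    unfolding term_class_def[of G a] term_class_def[of G b] by simp
  moreover have "a \<in> term_class G a" "b \<in> term_class G b"
    using assms by (auto simp: term_class_def intro: term_eq.refl)
  ultimately show ?thesis by blast
qed

lemma free_Cell_iff: "x \<in> Cell (free_two_cat G) \<longleftrightarrow> (\<exists>p a q. x = (p, term_class G a, q) \<and> typed G a p q)"
  by (auto simp: free_two_cat_def)

lemma free_CellI: "typed G a p q \<Longrightarrow> (p, term_class G a, q) \<in> Cell (free_two_cat G)"
  by (auto simp: free_Cell_iff)

lemma free_simps [simp]:
  "Ob (free_two_cat G) = GOb G" "Arr (free_two_cat G) = paths G"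
  "Dom (free_two_cat G) = psrc" "Cod (free_two_cat G) = ptgt"
  "Idt (free_two_cat G) x = (x, [], x)" "Cmp (free_two_cat G) = pcomp"
  "Src (free_two_cat G) (p, S, q) = p" "Tgt (free_two_cat G) (p, S, q) = q"
  "Idt2 (free_two_cat G) p = (p, term_class G (IdT p), p)"
  by (auto simp: free_two_cat_def)

lemma free_VCmp:
  assumes "well_formed_computad G" "typed G a p q" "typed G b q r"
  shows "VCmp (free_two_cat G) (q, term_class G b, r) (p, term_class G a, q)
    = (p, term_class G (VT b a), r)"
  using VT_class[OF assms] by (simp add: free_two_cat_def)

lemma free_HCmp:
  assumes "well_formed_computad G" "typed G a p q" "typed G b p' q'" "psrc p' = ptgt p"
  shows "HCmp (free_two_cat G) (p', term_class G b, q') (p, term_class G a, q)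
    = (pcomp p' p, term_class G (HT b a), pcomp q' q)"
  using HT_class[OF assms] by (simp add: free_two_cat_def)

lemma two_category_free_two_cat:
  assumes G: "well_formed_computad G"
  shows "two_category (free_two_cat G)"
proof -
  let ?C = "free_two_cat G"
  note tp = typed_paths[OF G]
  note V = free_VCmp[OF G] and H = free_HCmp[OF G]
  have IdT: "typed G (IdT p) p p" if "p \<in> paths G" for p using that by (rule typed.IdT)
  have emp: "(psrc p, [], psrc p) \<in> paths G" "(ptgt p, [], ptgt p) \<in> paths G" if "p \<in> paths G" for p
    using paths_ends[OF that] by (auto intro: paths.empty)
  have cat: "category ?C"
    by unfold_locales (simp_all add: paths_ends paths.empty pcomp_paths pcomp_unit pcomp_assoc)
  show ?thesis
  proof (intro two_category.intro cat two_category_axioms.intro)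
    fix a assume "a \<in> Cell ?C"
    then obtain p t q where a: "a = (p, term_class G t, q)" "typed G t p q"
      by (auto simp: free_Cell_iff)
    note e = tp[OF a(2)]
    show "Src ?C a \<in> Arr ?C" "Tgt ?C a \<in> Arr ?C" "Dom ?C (Tgt ?C a) = Dom ?C (Src ?C a)"
      "Cod ?C (Tgt ?C a) = Cod ?C (Src ?C a)"
      using e a(1) by auto
    show "VCmp ?C (Idt2 ?C (Tgt ?C a)) a = a"
      using e a term_class_eq[OF term_eq.VT_unit_left[OF a(2)]] by (simp add: V[OF a(2) IdT])
    show "VCmp ?C a (Idt2 ?C (Src ?C a)) = a"
      using e a term_class_eq[OF term_eq.VT_unit_right[OF a(2)]] by (simp add: V[OF IdT a(2)])
    show "HCmp ?C (Idt2 ?C (Idt ?C (Cod ?C (Src ?C a)))) a = a"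
      using e term_class_eq[OF term_eq.HT_unit_left[OF a(2)]] H[OF a(2) IdT[OF emp(2)[of p]]]
        pcomp_unit(1)[of p] pcomp_unit(1)[of q] by (simp add: a(1))
    show "HCmp ?C a (Idt2 ?C (Idt ?C (Dom ?C (Src ?C a)))) = a"
      using e term_class_eq[OF term_eq.HT_unit_right[OF a(2)]] H[OF IdT[OF emp(1)[of p]] a(2)]
        pcomp_unit(2)[of p] pcomp_unit(2)[of q] by (simp add: a(1))
  next
    fix f assume "f \<in> Arr ?C"
    then have "f \<in> paths G" by simp
    then show "Idt2 ?C f \<in> Cell ?C" "Src ?C (Idt2 ?C f) = f" "Tgt ?C (Idt2 ?C f) = f"
      using free_CellI[OF IdT, of f] by simp_all
  next
    fix a b assume "a \<in> Cell ?C" "b \<in> Cell ?C" and e: "Src ?C b = Tgt ?C a"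
    then obtain p t q t' r where a: "a = (p, term_class G t, q)" "typed G t p q" and
      b: "b = (q, term_class G t', r)" "typed G t' q r"
      by (auto simp: free_Cell_iff)
    show "VCmp ?C b a \<in> Cell ?C" "Src ?C (VCmp ?C b a) = Src ?C a" "Tgt ?C (VCmp ?C b a) = Tgt ?C b"
      using free_CellI[OF typed.VT[OF a(2) b(2)]] by (simp_all add: a(1) b(1) V[OF a(2) b(2)])
    fix c assume "c \<in> Cell ?C" "Src ?C c = Tgt ?C b"
    then obtain t'' s where c: "c = (r, term_class G t'', s)" "typed G t'' r s"
      using b by (auto simp: free_Cell_iff)
    show "VCmp ?C (VCmp ?C c b) a = VCmp ?C c (VCmp ?C b a)"
      using term_class_eq[OF term_eq.VT_assoc[OF a(2) b(2) c(2)]]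
      by (simp add: a(1) b(1) c(1) V[OF a(2) b(2)] V[OF b(2) c(2)]
          V[OF a(2) typed.VT[OF b(2) c(2)]] V[OF typed.VT[OF a(2) b(2)] c(2)])
  next
    fix a b assume "a \<in> Cell ?C" "b \<in> Cell ?C" and e0: "Dom ?C (Src ?C b) = Cod ?C (Src ?C a)"
    then obtain p t q p' t' q' where a: "a = (p, term_class G t, q)" "typed G t p q" and
      b: "b = (p', term_class G t', q')" "typed G t' p' q'" and e: "psrc p' = ptgt p"
      by (auto simp: free_Cell_iff)
    show "HCmp ?C b a \<in> Cell ?C" "Src ?C (HCmp ?C b a) = Cmp ?C (Src ?C b) (Src ?C a)"
      "Tgt ?C (HCmp ?C b a) = Cmp ?C (Tgt ?C b) (Tgt ?C a)"
      using free_CellI[OF typed.HT[OF a(2) b(2) e]] by (simp_all add: a(1) b(1) H[OF a(2) b(2) e])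
    fix c assume "c \<in> Cell ?C" "Dom ?C (Src ?C c) = Cod ?C (Src ?C b)"
    then obtain p'' t'' q'' where c: "c = (p'', term_class G t'', q'')" "typed G t'' p'' q''"
        and e': "psrc p'' = ptgt p'"
      using b by (auto simp: free_Cell_iff)
    show "HCmp ?C (HCmp ?C c b) a = HCmp ?C c (HCmp ?C b a)"
      using term_class_eq[OF term_eq.HT_assoc[OF a(2) b(2) c(2) e e']] e e'
      by (simp add: a(1) b(1) c(1) H[OF a(2) b(2) e] H[OF b(2) c(2) e'] pcomp_assoc
          H[OF a(2) typed.HT[OF b(2) c(2) e']] H[OF typed.HT[OF a(2) b(2) e] c(2)])
  next
    fix f g assume "f \<in> Arr ?C" "g \<in> Arr ?C" "Dom ?C g = Cod ?C f"
    then have "f \<in> paths G" "g \<in> paths G" "psrc g = ptgt f" by auto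
    then show "HCmp ?C (Idt2 ?C g) (Idt2 ?C f) = Idt2 ?C (Cmp ?C g f)"
      using H[OF IdT IdT, of f g] term_class_eq[OF term_eq.HT_IdT, of f G g] by simp
  next
    fix a a' b b' assume *: "a \<in> Cell ?C" "a' \<in> Cell ?C" "b \<in> Cell ?C" "b' \<in> Cell ?C"
      "Src ?C a' = Tgt ?C a" "Src ?C b' = Tgt ?C b" "Dom ?C (Src ?C b) = Cod ?C (Src ?C a)"
    then obtain p t q t' r where a: "a = (p, term_class G t, q)" "typed G t p q" and
      a': "a' = (q, term_class G t', r)" "typed G t' q r"
      by (auto simp: free_Cell_iff)
    obtain p2 t2 q2 t2' r2 where b: "b = (p2, term_class G t2, q2)" "typed G t2 p2 q2" and
      b': "b' = (q2, term_class G t2', r2)" "typed G t2' q2 r2"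
      using * by (auto simp: free_Cell_iff)
    have e: "psrc p2 = ptgt p" using * a b by simp
    then have e': "psrc q2 = ptgt q" using tp[OF a(2)] tp[OF b(2)] by simp
    show "HCmp ?C (VCmp ?C b' b) (VCmp ?C a' a) = VCmp ?C (HCmp ?C b' a') (HCmp ?C b a)"
      using term_class_eq[OF term_eq.interchange[OF a(2) a'(2) b(2) b'(2) e]]
      by (simp add: a(1) a'(1) b(1) b'(1) V[OF a(2) a'(2)] V[OF b(2) b'(2)] H[OF a(2) b(2) e]
          H[OF a'(2) b'(2) e'] H[OF typed.VT[OF a(2) a'(2)] typed.VT[OF b(2) b'(2)] e]
          V[OF typed.HT[OF a(2) b(2) e] typed.HT[OF a'(2) b'(2) e']])
  qed
qed

lemma well_formed_example: "well_formed_computad example_computad"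
  unfolding well_formed_computad_def
  by (auto simp: example_computad_def intro!: paths.intros)

lemma two_category_exA: "two_category exA"
  by (rule two_category_free_two_cat[OF well_formed_example])

lemma exf_Arr: "exf \<in> Arr exA"
  by (auto simp: free_two_cat_def example_computad_def intro!: paths.intros)

lemma two_category_Two: "two_category Two"
  by unfold_locales (auto simp: Two_def)

lemma two_functor_arrow_functor:
  assumes "two_category A" "f \<in> Arr A"
  shows "two_functor Two A (arrow_functor A f)"
proof -
  interpret two_category A by fact
  note ax = Dom_Ob Cod_Ob Idt_Arr Dom_Idt Cod_Idt Idt2_Cell Src_Idt2 Tgt_Idt2
  have "Idt A (Dom A f) \<odot>\<^bsub>A\<^esub> Idt A (Dom A f) = Idt A (Dom A f)"
    "Idt A (Cod A f) \<odot>\<^bsub>A\<^esub> Idt A (Cod A f) = Idt A (Cod A f)"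
    using assms(2) Cmp_Idt_left[of "Idt A (Dom A f)"] Cmp_Idt_left[of "Idt A (Cod A f)"]
    by (simp_all add: ax)
  moreover have "Idt2 A g \<bullet>\<^bsub>A\<^esub> Idt2 A g = Idt2 A g" if "g \<in> Arr A" for g
    using VCmp_Idt2_left[of "Idt2 A g"] that by (simp add: ax)
  ultimately show ?thesis using assms(2)
    by (auto simp: two_functor_def arrow_functor_def Two_def ax HCmp_Idt2 Cmp_Idt_left Cmp_Idt_right)
qed

lemma two_functor_Delta0:
  assumes "two_category A" "two_category I" "X \<in> Ob A"
  shows "two_functor I A (Delta0 I A X)"
proof -
  interpret two_category A by fact
  interpret I: two_category I by fact
  have "Idt A X \<odot>\<^bsub>A\<^esub> Idt A X = Idt A X"
    using assms(3) Cmp_Idt_left[of "Idt A X"] by (simp add: Idt_Arr Cod_Idt)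
  moreover have "Idt2 A (Idt A X) \<bullet>\<^bsub>A\<^esub> Idt2 A (Idt A X) = Idt2 A (Idt A X)"
    using VCmp_Idt2_left[of "Idt2 A (Idt A X)"] assms(3) by (simp add: Idt_Arr Idt2_Cell Tgt_Idt2)
  moreover have "Idt2 A (Idt A X) \<star>\<^bsub>A\<^esub> Idt2 A (Idt A X) = Idt2 A (Idt A X)"
    using HCmp_Idt2[of "Idt A X" "Idt A X"] assms(3) calculation by (simp add: Idt_Arr Cod_Idt Dom_Idt)
  ultimately show ?thesis using assms(3)
    by (auto simp: two_functor_def Delta0_def Idt_Arr Dom_Idt Cod_Idt Idt2_Cell Src_Idt2 Tgt_Idt2
        I.Dom_Ob I.Cod_Ob I.Idt_Arr I.Cmp_Arr I.Src_Arr I.Tgt_Arr I.Idt2_Cell I.VCmp_Cell I.HCmp_Cell)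
qed

lemma id_cone_lax_cone:
  assumes "two_category A" "f \<in> Arr A"
  shows "id_cone A f \<in> lax_cones Two A (arrow_functor A f) (Dom A f)"
proof -
  interpret two_category A by fact
  note ax = Dom_Ob Cod_Ob Idt_Arr Dom_Idt Cod_Idt Idt2_Cell Src_Idt2 Tgt_Idt2
  have "Idt A (Dom A f) \<odot>\<^bsub>A\<^esub> Idt A (Dom A f) = Idt A (Dom A f)"
    "Idt A (Cod A f) \<odot>\<^bsub>A\<^esub> Idt A (Cod A f) = Idt A (Cod A f)"
    using assms(2) Cmp_Idt_left[of "Idt A (Dom A f)"] Cmp_Idt_left[of "Idt A (Cod A f)"]
    by (simp_all add: ax)
  moreover have "Idt2 A g \<bullet>\<^bsub>A\<^esub> Idt2 A g = Idt2 A g" if "g \<in> Arr A" for g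
    using VCmp_Idt2_left[of "Idt2 A g"] that by (simp add: ax)
  moreover have "two_functor Two A (arrow_functor A f)" "two_functor Two A (Delta0 Two A (Dom A f))"
    using two_functor_arrow_functor[OF assms] two_functor_Delta0[OF assms(1) two_category_Two] assms
    by (auto simp: ax)
  ultimately have "lax_natural Two A (id_cone A f)" using assms(2)
    unfolding lax_natural_def Let_def id_cone_def
    by (auto simp: hom_def Two_def Delta0_def arrow_functor_def ax HCmp_Idt2 Cmp_Idt_left Cmp_Idt_right)
  then show ?thesis by (auto simp: lax_cones_def hom_def Lax_def Let_def id_cone_def)
qed

end

theory Submission
  imports Defs
begin

(* The 2-category generated by the data has alpha as its only non-identity 2-cell, so parallel
   2-cells are equal and 2-cells into A are identities. Hence a morphism (h, phi) from a cone mu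
   to (A, id_f) has h = mu_0 (phi_0 is a 2-cell into A) and phi_1 = mu_f, which gives
   2-terminality. But the cones in the image of post-composition with id_f have second component
   f h, so the cone (alpha_0, alpha_1, alpha) is missed. *)

section \<open>Isomorphisms of categories, and projections of the constructions\<close>

lemma isomorphic_terminal_catI:
  assumes "Ob C = {x}" "Arr C = {u}" "Dom C u = x" "Cod C u = x" "Idt C x = u" "u \<odot>\<^bsub>C\<^esub> u = u"
  shows "isomorphic_categories C terminal_cat"
  unfolding isomorphic_categories_def isomorphism_of_categories_def
  by (rule exI[of _ "\<lparr>onOb = \<lambda>_. (), onArr = \<lambda>_. ()\<rparr>"],
      intro conjI exI[of _ "\<lparr>onOb = \<lambda>_. x, onArr = \<lambda>_. u\<rparr>"])
    (use assms in \<open>auto simp: is_functor_def terminal_cat_def hom_def\<close>)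

text \<open>This links the last two claims of the theorem: a single missed object in one
  hom-category already rules out a lax-limit.\<close>

lemma isomorphism_surjective_on_objects:
  assumes "isomorphism_of_categories C D T"
  shows "surjective_on_objects C D T"
  using assms unfolding isomorphism_of_categories_def surjective_on_objects_def is_functor_def by blast

lemma Lax_simps [simp]:
  "Ob (Lax I A) = {F. two_functor I A F}" "Arr (Lax I A) = {\<mu>. lax_natural I A \<mu>}"
  "Dom (Lax I A) = TSrc" "Cod (Lax I A) = TTgt"
  "Cell (Lax I A) = {\<phi>. modification I A \<phi>}" "Src (Lax I A) = MSrc" "Tgt (Lax I A) = MTgt"
  by (simp_all add: Lax_def Let_def)

lemma Two_simps [simp]:
  "Ob Two = {0, 1}" "Arr Two = {(0, 0), (0, 1), (1, 1)}" "Dom Two = fst" "Cod Two = snd"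
  "Idt Two i = (i, i)"
  by (simp_all add: Two_def)

lemma two_functorD:
  assumes "two_functor I A F"
  shows "i \<in> Ob I \<Longrightarrow> F0 F i \<in> Ob A" "f \<in> Arr I \<Longrightarrow> F1 F f \<in> Arr A"
    "a \<in> Cell I \<Longrightarrow> F2 F a \<in> Cell A"
    "f \<in> Arr I \<Longrightarrow> Dom A (F1 F f) = F0 F (Dom I f)" "f \<in> Arr I \<Longrightarrow> Cod A (F1 F f) = F0 F (Cod I f)"
    "a \<in> Cell I \<Longrightarrow> Src A (F2 F a) = F1 F (Src I a)" "a \<in> Cell I \<Longrightarrow> Tgt A (F2 F a) = F1 F (Tgt I a)"
    "i \<in> Ob I \<Longrightarrow> F1 F (Idt I i) = Idt A (F0 F i)"
    "\<lbrakk>f \<in> Arr I; g \<in> Arr I; Dom I g = Cod I f\<rbrakk> \<Longrightarrow> F1 F (g \<odot>\<^bsub>I\<^esub> f) = F1 F g \<odot>\<^bsub>A\<^esub> F1 F f"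
  using assms unfolding two_functor_def by (auto simp: PiE_iff)

lemma lax_naturalD:
  assumes "lax_natural I A \<mu>"
  shows "two_functor I A (TSrc \<mu>)" "two_functor I A (TTgt \<mu>)"
    "T1 \<mu> \<in> Ob I \<rightarrow>\<^sub>E Arr A" "T2 \<mu> \<in> Arr I \<rightarrow>\<^sub>E Cell A"
    "i \<in> Ob I \<Longrightarrow> T1 \<mu> i \<in> Arr A"
    "i \<in> Ob I \<Longrightarrow> Dom A (T1 \<mu> i) = F0 (TSrc \<mu>) i" "i \<in> Ob I \<Longrightarrow> Cod A (T1 \<mu> i) = F0 (TTgt \<mu>) i"
    "f \<in> Arr I \<Longrightarrow> T2 \<mu> f \<in> Cell A"
    "f \<in> Arr I \<Longrightarrow> Src A (T2 \<mu> f) = F1 (TTgt \<mu>) f \<odot>\<^bsub>A\<^esub> T1 \<mu> (Dom I f)"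
    "f \<in> Arr I \<Longrightarrow> Tgt A (T2 \<mu> f) = T1 \<mu> (Cod I f) \<odot>\<^bsub>A\<^esub> F1 (TSrc \<mu>) f"
  using assms unfolding lax_natural_def Let_def by (auto simp: hom_def PiE_iff)

lemma modificationD:
  assumes "modification I A \<phi>"
  shows "lax_natural I A (MSrc \<phi>)" "lax_natural I A (MTgt \<phi>)"
    "Mcomp \<phi> \<in> Ob I \<rightarrow>\<^sub>E Cell A"
    "i \<in> Ob I \<Longrightarrow> Mcomp \<phi> i \<in> Cell A"
    "i \<in> Ob I \<Longrightarrow> Src A (Mcomp \<phi> i) = T1 (MSrc \<phi>) i"
    "i \<in> Ob I \<Longrightarrow> Tgt A (Mcomp \<phi> i) = T1 (MTgt \<phi>) i"
  using assms unfolding modification_def Let_def by (auto simp: PiE_iff)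

section \<open>Lax transformations and modifications into a locally thin 2-category\<close>

locale locally_thin = two_category +
  assumes thin: "\<lbrakk>a \<in> Cell C; b \<in> Cell C; Src C a = Src C b; Tgt C a = Tgt C b\<rbrakk> \<Longrightarrow> a = b"
begin

text \<open>Simplification with these rules shows that a well-typed composite is a 2-cell and
  computes its source and target, which is all that an appeal to \<open>thin\<close> asks
  for.\<close>

lemmas typing = Src_Arr Tgt_Arr Dom_Tgt Cod_Tgt Idt2_Cell Src_Idt2 Tgt_Idt2
  VCmp_Cell Src_VCmp Tgt_VCmp HCmp_Cell Src_HCmp Tgt_HCmp
  Dom_Ob Cod_Ob Idt_Arr Dom_Idt Cod_Idt Cmp_Arr Dom_Cmp Cod_Cmp Cmp_Idt_left Cmp_Idt_right

text \<open>The object of the identity is a variable tied to \<open>f\<close> by an equation. In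
  this form the unit laws still apply once the simplifier has replaced \<open>Dom C f\<close> or
  \<open>Cod C f\<close> by its value.\<close>

lemma Cmp_Idt_left': "f \<in> Arr C \<Longrightarrow> Cod C f = y \<Longrightarrow> Idt C y \<odot> f = f"
  and Cmp_Idt_right': "f \<in> Arr C \<Longrightarrow> Dom C f = x \<Longrightarrow> f \<odot> Idt C x = f"
  using Cmp_Idt_left Cmp_Idt_right by blast+

end

locale locally_thin_target = locally_thin A + I: two_category I
  for A :: "('p, 'n, 'd) two_cat" and I :: "('o, 'm, 'c) two_cat"
begin

text \<open>The axioms at identities, composites and 2-cells each equate two parallel 2-cells, so
  \<open>thin\<close> reduces them to boundary computations. For composites the boundaries agree
  only after reassociation, hence \<open>Cmp_assoc\<close> there.\<close>

lemma lax_naturalI: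
  assumes F: "two_functor I A (TSrc \<mu>)" and G: "two_functor I A (TTgt \<mu>)"
    and ext: "T1 \<mu> \<in> extensional (Ob I)" "T2 \<mu> \<in> extensional (Arr I)"
    and T1: "\<And>i. i \<in> Ob I \<Longrightarrow> T1 \<mu> i \<in> hom A (F0 (TSrc \<mu>) i) (F0 (TTgt \<mu>) i)"
    and T2: "\<And>f. f \<in> Arr I \<Longrightarrow> T2 \<mu> f \<in> Cell A"
      "\<And>f. f \<in> Arr I \<Longrightarrow> Src A (T2 \<mu> f) = F1 (TTgt \<mu>) f \<odot>\<^bsub>A\<^esub> T1 \<mu> (Dom I f)"
      "\<And>f. f \<in> Arr I \<Longrightarrow> Tgt A (T2 \<mu> f) = T1 \<mu> (Cod I f) \<odot>\<^bsub>A\<^esub> F1 (TSrc \<mu>) f"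
  shows "lax_natural I A \<mu>"
proof -
  note FG = two_functorD[OF F] two_functorD[OF G]
  have T1': "T1 \<mu> i \<in> Arr A" "Dom A (T1 \<mu> i) = F0 (TSrc \<mu>) i" "Cod A (T1 \<mu> i) = F0 (TTgt \<mu>) i"
    if "i \<in> Ob I" for i
    using T1[OF that] by (auto simp: hom_def)
  note I = I.Dom_Ob I.Cod_Ob I.Idt_Arr I.Dom_Idt I.Cod_Idt I.Cmp_Arr I.Dom_Cmp I.Cod_Cmp
    I.Src_Arr I.Tgt_Arr I.Dom_Tgt I.Cod_Tgt
  note s = FG T1' T2 I typing Cmp_Idt_left' Cmp_Idt_right'
  have "T2 \<mu> (Idt I i) = Idt2 A (T1 \<mu> i)" if "i \<in> Ob I" for i
    by (rule thin) (use that in \<open>simp_all add: s\<close>)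
  moreover have "T2 \<mu> (g \<odot>\<^bsub>I\<^esub> f) =
      (T2 \<mu> g \<star>\<^bsub>A\<^esub> Idt2 A (F1 (TSrc \<mu>) f)) \<bullet>\<^bsub>A\<^esub> (Idt2 A (F1 (TTgt \<mu>) g) \<star>\<^bsub>A\<^esub> T2 \<mu> f)"
    if "f \<in> Arr I" "g \<in> Arr I" "Dom I g = Cod I f" for f g
    by (rule thin) (use that in \<open>simp_all add: s Cmp_assoc\<close>)
  moreover have "T2 \<mu> (Tgt I a) \<bullet>\<^bsub>A\<^esub> (F2 (TTgt \<mu>) a \<star>\<^bsub>A\<^esub> Idt2 A (T1 \<mu> (Dom I (Src I a)))) =
      (Idt2 A (T1 \<mu> (Cod I (Src I a))) \<star>\<^bsub>A\<^esub> F2 (TSrc \<mu>) a) \<bullet>\<^bsub>A\<^esub> T2 \<mu> (Src I a)"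
    if "a \<in> Cell I" for a
    by (rule thin) (use that in \<open>simp_all add: s\<close>)
  ultimately show ?thesis
    using F G ext T1 T1'(1) T2 unfolding lax_natural_def Let_def by (auto simp: PiE_iff)
qed

text \<open>The modification axiom is again an equation between parallel 2-cells, so only the types
  of the components remain to be checked.\<close>

lemma modificationI:
  assumes \<mu>: "lax_natural I A (MSrc \<phi>)" and \<nu>: "lax_natural I A (MTgt \<phi>)"
    and par: "TSrc (MTgt \<phi>) = TSrc (MSrc \<phi>)" "TTgt (MTgt \<phi>) = TTgt (MSrc \<phi>)"
    and ext: "Mcomp \<phi> \<in> extensional (Ob I)"
    and comp: "\<And>i. i \<in> Ob I \<Longrightarrow> Mcomp \<phi> i \<in> Cell A"
      "\<And>i. i \<in> Ob I \<Longrightarrow> Src A (Mcomp \<phi> i) = T1 (MSrc \<phi>) i"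
      "\<And>i. i \<in> Ob I \<Longrightarrow> Tgt A (Mcomp \<phi> i) = T1 (MTgt \<phi>) i"
  shows "modification I A \<phi>"
proof -
  note FG = two_functorD[OF lax_naturalD(1)[OF \<mu>]] two_functorD[OF lax_naturalD(2)[OF \<mu>]]
  note s = FG lax_naturalD(5-)[OF \<mu>] lax_naturalD(5-)[OF \<nu>] par comp I.Dom_Ob I.Cod_Ob typing
  have "T2 (MTgt \<phi>) f \<bullet>\<^bsub>A\<^esub> (Idt2 A (F1 (TTgt (MSrc \<phi>)) f) \<star>\<^bsub>A\<^esub> Mcomp \<phi> (Dom I f)) =
      (Mcomp \<phi> (Cod I f) \<star>\<^bsub>A\<^esub> Idt2 A (F1 (TSrc (MSrc \<phi>)) f)) \<bullet>\<^bsub>A\<^esub> T2 (MSrc \<phi>) f"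
    if "f \<in> Arr I" for f
    by (rule thin) (use that in \<open>simp_all add: s\<close>)
  then show ?thesis
    using assms unfolding modification_def Let_def by (auto simp: PiE_iff)
qed

text \<open>A common source and target make the components parallel at every object of
  \<open>I\<close>, where \<open>thin\<close> identifies them; outside \<open>Ob I\<close> both
  families are \<open>undefined\<close>.\<close>

lemma modification_eqI:
  assumes "modification I A \<phi>" "modification I A \<psi>" "MSrc \<phi> = MSrc \<psi>" "MTgt \<phi> = MTgt \<psi>"
  shows "\<phi> = (\<psi> :: ('o, 'm, 'c, 'p, 'n, 'd) modif)"
proof -
  note D = modificationD[OF assms(1)] modificationD[OF assms(2)]
  have "Mcomp \<phi> = Mcomp \<psi>"
    by (rule PiE_ext[OF D(3) D(9)], rule thin) (simp_all add: D assms)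
  then show ?thesis using assms by simp
qed

text \<open>The pasted 2-cells have the right boundaries up to associativity, and thinness settles
  the axioms. The lemma is needed for the source \<open>\<nu>\<Delta>h\<close> of the modification
  in a slice morphism.\<close>

lemma lax_natural_Cmp:
  assumes \<mu>: "lax_natural I A \<mu>" and \<nu>: "lax_natural I A \<nu>" and "TSrc \<nu> = TTgt \<mu>"
  shows "lax_natural I A (\<nu> \<odot>\<^bsub>Lax I A\<^esub> \<mu>)"
proof -
  note F = lax_naturalD(1,2)[OF \<mu>] lax_naturalD(2)[OF \<nu>]
  note s = two_functorD(1-5)[OF F(1)] two_functorD(1-5)[OF F(2)] two_functorD(1-5)[OF F(3)]
    lax_naturalD(5-)[OF \<mu>] lax_naturalD(5-)[OF \<nu>] assms(3) I.Dom_Ob I.Cod_Ob typing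
  show ?thesis
    by (rule lax_naturalI) (simp_all add: Lax_def Let_def F s Cmp_assoc hom_def)
qed

lemma lax_natural_Delta1:
  assumes "h \<in> Arr A"
  shows "lax_natural I A (Delta1 I A h)"
proof -
  have "two_functor I A (Delta0 I A (Dom A h))" "two_functor I A (Delta0 I A (Cod A h))"
    using assms two_functor_Delta0[OF two_category_axioms I.two_category_axioms]
    by (simp_all add: typing)
  then show ?thesis
    by (intro lax_naturalI)
      (use assms in \<open>simp_all add: Delta1_def Delta0_def typing hom_def I.Dom_Ob I.Cod_Ob\<close>)
qed

end

section \<open>The lax-slice, and 2-terminality of the identity cone\<close>

lemma lax_slice_Ob: "(X, \<mu>) \<in> Ob (lax_slice I A F) \<longleftrightarrow> X \<in> Ob A \<and> \<mu> \<in> lax_cones I A F X"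
  by (simp add: lax_slice_def Let_def)

lemma lax_slice_Arr:
  "((X, \<mu>), (h, \<phi>), (Y, \<nu>)) \<in> Arr (lax_slice I A F) \<longleftrightarrow>
    X \<in> Ob A \<and> \<mu> \<in> lax_cones I A F X \<and> Y \<in> Ob A \<and> \<nu> \<in> lax_cones I A F Y \<and> h \<in> hom A X Y \<and>
    modification I A \<phi> \<and> MSrc \<phi> = \<nu> \<odot>\<^bsub>Lax I A\<^esub> Delta1 I A h \<and> MTgt \<phi> = \<mu>"
  unfolding lax_slice_def Let_def by (simp add: eq_commute) blast

lemma lax_slice_Cell:
  "((P, (h, \<phi>), (Y, \<nu>)), \<beta>, (Q, (k, \<psi>), R)) \<in> Cell (lax_slice I A F) \<longleftrightarrow>
    Q = P \<and> R = (Y, \<nu>) \<and>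
    (P, (h, \<phi>), (Y, \<nu>)) \<in> Arr (lax_slice I A F) \<and> (P, (k, \<psi>), (Y, \<nu>)) \<in> Arr (lax_slice I A F) \<and>
    \<beta> \<in> Cell A \<and> Src A \<beta> = h \<and> Tgt A \<beta> = k \<and>
    \<psi> \<bullet>\<^bsub>Lax I A\<^esub> (Idt2 (Lax I A) \<nu> \<star>\<^bsub>Lax I A\<^esub> Delta2 I A \<beta>) = \<phi>"
  unfolding lax_slice_def Let_def two_cat.simps cat.simps mem_Collect_eq by (cases R) blast

lemma lax_slice_simps:
  "Dom (lax_slice I A F) (P, u, Q) = P" "Cod (lax_slice I A F) (P, u, Q) = Q"
  "Src (lax_slice I A F) (s, \<beta>, t) = s" "Tgt (lax_slice I A F) (s, \<beta>, t) = t"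
  "Idt2 (lax_slice I A F) (P, (h, \<phi>), Q) = ((P, (h, \<phi>), Q), Idt2 A h, (P, (h, \<phi>), Q))"
  "VCmp (lax_slice I A F) (s', \<gamma>, t') (s, \<beta>, t) = (s, \<gamma> \<bullet>\<^bsub>A\<^esub> \<beta>, t')"
  by (simp_all add: lax_slice_def Let_def)

text \<open>Stated for an abstract arrow, so that the free 2-category enters through two properties
  only: parallel 2-cells agree, and a 2-cell into the domain of \<open>f\<close> has equal source
  and target. For every cone the hom-category is computed outright: its only object is
  \<open>m\<close> and its only arrow is \<open>?u\<close>.\<close>

lemma two_terminal_id_cone:
  fixes A :: "('p, 'n, 'd) two_cat"
  assumes A: "locally_thin A" and f: "f \<in> Arr A"
    and discrete: "\<And>a. \<lbrakk>a \<in> Cell A; Cod A (Src A a) = Dom A f\<rbrakk> \<Longrightarrow> Tgt A a = Src A a"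
  shows "two_terminal (lax_slice Two A (arrow_functor A f)) (Dom A f, id_cone A f)"
  unfolding two_terminal_def
proof
  interpret locally_thin A by (rule A)
  interpret locally_thin_target A Two
    by (intro locally_thin_target.intro A two_category_Two)
  let ?S = "lax_slice Two A (arrow_functor A f)" and ?\<nu> = "id_cone A f" and ?L = "Lax Two A"
  have cone: "?\<nu> \<in> lax_cones Two A (arrow_functor A f) (Dom A f)"
    by (rule id_cone_lax_cone[OF two_category_axioms f])
  then have \<nu>: "lax_natural Two A ?\<nu>" by (simp add: lax_cones_def hom_def)
  show "(Dom A f, ?\<nu>) \<in> Ob ?S" using cone f by (simp add: lax_slice_Ob Dom_Ob)
  show "\<forall>P\<in>Ob ?S. isomorphic_categories (hom_cat ?S P (Dom A f, ?\<nu>)) terminal_cat"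
  proof
    fix P assume P: "P \<in> Ob ?S"
    obtain X \<mu> where P_eq: "P = (X, \<mu>)" by (cases P)
    have X: "X \<in> Ob A" and \<mu>_cone: "\<mu> \<in> lax_cones Two A (arrow_functor A f) X"
      using P by (simp_all add: P_eq lax_slice_Ob)
    then have \<mu>: "lax_natural Two A \<mu>" "TSrc \<mu> = Delta0 Two A X" "TTgt \<mu> = arrow_functor A f"
      by (simp_all add: lax_cones_def hom_def)
    have \<mu>0: "T1 \<mu> 0 \<in> Arr A" "Dom A (T1 \<mu> 0) = X" "Cod A (T1 \<mu> 0) = Dom A f"
      and \<mu>1: "T1 \<mu> 1 \<in> Arr A" "Dom A (T1 \<mu> 1) = X" "Cod A (T1 \<mu> 1) = Cod A f"
      using lax_naturalD(5-7)[OF \<mu>(1), of 0] lax_naturalD(5-7)[OF \<mu>(1), of 1]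
      by (simp_all add: \<mu> Delta0_def arrow_functor_def Let_def)
    \<comment> \<open>Since \<open>\<Delta>X\<close> sends the arrow to an identity, the target of
      this component collapses from a composite to \<open>T1 \<mu> 1\<close>.\<close>
    have \<mu>2: "T2 \<mu> (0, 1) \<in> Cell A" "Src A (T2 \<mu> (0, 1)) = f \<odot>\<^bsub>A\<^esub> T1 \<mu> 0"
      "Tgt A (T2 \<mu> (0, 1)) = T1 \<mu> 1"
      using lax_naturalD(8-10)[OF \<mu>(1), of "(0, 1)"] \<mu>1
      by (simp_all add: \<mu> Delta0_def arrow_functor_def Let_def Cmp_Idt_right')
    \<comment> \<open>The composite cone has components \<open>h\<close> and
      \<open>f \<odot> h\<close>, so a modification from it to \<mu> consists of 2-cells from
      \<open>h\<close> to \<open>T1 \<mu> 0\<close> and from \<open>f \<odot> h\<close> to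
      \<open>T1 \<mu> 1\<close>.\<close>
    have comp: "lax_natural Two A (?\<nu> \<odot>\<^bsub>?L\<^esub> Delta1 Two A h)"
      "TSrc (?\<nu> \<odot>\<^bsub>?L\<^esub> Delta1 Two A h) = Delta0 Two A X"
      "TTgt (?\<nu> \<odot>\<^bsub>?L\<^esub> Delta1 Two A h) = arrow_functor A f"
      "T1 (?\<nu> \<odot>\<^bsub>?L\<^esub> Delta1 Two A h) 0 = h"
      "T1 (?\<nu> \<odot>\<^bsub>?L\<^esub> Delta1 Two A h) 1 = f \<odot>\<^bsub>A\<^esub> h"
      if "h \<in> hom A X (Dom A f)" for h
    proof -
      have h: "h \<in> Arr A" "Dom A h = X" "Cod A h = Dom A f" using that by (auto simp: hom_def)
      show "lax_natural Two A (?\<nu> \<odot>\<^bsub>?L\<^esub> Delta1 Two A h)"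
        by (rule lax_natural_Cmp[OF lax_natural_Delta1 \<nu>])
          (use h in \<open>simp_all add: id_cone_def Delta1_def\<close>)
    qed (use that in \<open>auto simp: hom_def Lax_def Let_def id_cone_def Delta1_def Cmp_Idt_left'\<close>)
    \<comment> \<open>With \<open>h = T1 \<mu> 0\<close>, the component at 1 must run from
      \<open>f \<odot> T1 \<mu> 0\<close> to \<open>T1 \<mu> 1\<close>. This is the boundary of the
      cone's own 2-cell \<open>T2 \<mu> (0, 1)\<close>.\<close>
    define \<phi> :: "(nat, nat \<times> nat, nat \<times> nat, 'p, 'n, 'd) modif" where "\<phi> =
      \<lparr>MSrc = ?\<nu> \<odot>\<^bsub>?L\<^esub> Delta1 Two A (T1 \<mu> 0), MTgt = \<mu>,
       Mcomp = (\<lambda>i\<in>{0, 1}. if i = 0 then Idt2 A (T1 \<mu> 0) else T2 \<mu> (0, 1))\<rparr>"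
    define m where "m = ((X, \<mu>), (T1 \<mu> 0, \<phi>), (Dom A f, ?\<nu>))"
    have h0: "T1 \<mu> 0 \<in> hom A X (Dom A f)" using \<mu>0 by (simp add: hom_def)
    have \<phi>: "modification Two A \<phi>"
      by (rule modificationI)
        (use \<mu> \<mu>0 \<mu>1 \<mu>2 comp[OF h0] in \<open>auto simp: \<phi>_def typing\<close>)
    have m_Arr: "m \<in> Arr ?S"
      using X \<mu>_cone cone f h0 \<phi> by (simp add: m_def lax_slice_Arr Dom_Ob) (simp add: \<phi>_def)
    have unique: "n = m" if "n \<in> hom ?S P (Dom A f, ?\<nu>)" for n
    proof -
      obtain P' h \<psi> Q' where n: "n = (P', (h, \<psi>), Q')" by (metis surj_pair)
      have ends: "P' = (X, \<mu>)" "Q' = (Dom A f, ?\<nu>)" and n_Arr: "n \<in> Arr ?S"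
        using that by (auto simp: hom_def n P_eq lax_slice_simps)
      have h: "h \<in> hom A X (Dom A f)" and \<psi>: "modification Two A \<psi>"
        "MSrc \<psi> = ?\<nu> \<odot>\<^bsub>?L\<^esub> Delta1 Two A h" "MTgt \<psi> = \<mu>"
        using n_Arr by (simp_all add: n ends lax_slice_Arr)
      note D = modificationD(4-6)[OF \<psi>(1), of 0]
      \<comment> \<open>The component of \<psi> at 0 runs from \<open>h\<close> to
        \<open>T1 \<mu> 0\<close> and lands in \<open>Dom A f\<close>, so \<open>discrete\<close>
        equates its ends. Then \<psi> and \<phi> share source and target, and thinness identifies
        them.\<close>
      have "h = T1 \<mu> 0"
        using discrete[of "Mcomp \<psi> 0"] D h comp[OF h] by (simp add: \<psi> hom_def)
      moreover from this have "\<psi> = \<phi>"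
        using modification_eqI[OF \<psi>(1) \<phi>] by (simp add: \<psi> \<phi>_def)
      ultimately show ?thesis by (simp add: n ends m_def)
    qed
    moreover have "m \<in> hom ?S P (Dom A f, ?\<nu>)"
      using m_Arr by (simp add: hom_def P_eq) (simp add: m_def lax_slice_simps)
    ultimately have hom: "hom ?S P (Dom A f, ?\<nu>) = {m}" by blast
    let ?u = "(m, Idt2 A (T1 \<mu> 0), m)"
    \<comment> \<open>This is the condition for \<open>Idt2 A (T1 \<mu> 0)\<close> to be a 2-cell of
      the slice from \<open>m\<close> to itself. The whiskered modification has the identities of
      \<open>T1 \<mu> 0\<close> and \<open>f \<odot> T1 \<mu> 0\<close> as components.\<close>
    have "\<phi> \<bullet>\<^bsub>?L\<^esub> (Idt2 ?L ?\<nu> \<star>\<^bsub>?L\<^esub> Delta2 Two A (Idt2 A (T1 \<mu> 0))) = \<phi>"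
      using \<mu>0 \<mu>2 f VCmp_Idt2_right[of "Idt2 A (T1 \<mu> 0)"] VCmp_Idt2_right[of "T2 \<mu> (0, 1)"]
      by (auto simp: Lax_def Let_def \<phi>_def Delta2_def id_cone_def HCmp_Idt2 typing Cmp_Idt_left'
          intro!: restrict_ext)
    then have u: "?u \<in> Cell ?S"
      using m_Arr \<mu>0 by (simp add: lax_slice_Cell m_def typing)
    have a_eq_u: "a = ?u" if a: "a \<in> Cell ?S" "Src ?S a = m" "Tgt ?S a = m" for a
    proof -
      obtain s \<beta> t where "a = (s, \<beta>, t)" by (metis surj_pair)
      moreover from this have "s = m" "t = m" using a(2,3) by (simp_all only: lax_slice_simps)
      ultimately have a_eq: "a = (m, \<beta>, m)" by simp
      then have "\<beta> \<in> Cell A" "Src A \<beta> = T1 \<mu> 0" "Tgt A \<beta> = T1 \<mu> 0"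
        using a(1) by (simp_all add: m_def lax_slice_Cell)
      then have "\<beta> = Idt2 A (T1 \<mu> 0)" using \<mu>0(1) by (intro thin) (simp_all add: typing)
      then show ?thesis by (simp add: a_eq)
    qed
    have "Arr (hom_cat ?S P (Dom A f, ?\<nu>)) = {a \<in> Cell ?S. Src ?S a = m \<and> Tgt ?S a = m}"
      by (simp add: hom_cat_def hom)
    also have "\<dots> = {?u}"
    proof (intro equalityI subsetI; elim CollectE conjE insertE emptyE)
      fix a assume "a \<in> Cell ?S" "Src ?S a = m" "Tgt ?S a = m"
      then have "a = ?u" by (rule a_eq_u)
      then show "a \<in> {?u}" by (simp only: singleton_iff)
    next
      fix a assume "a = ?u"
      then show "a \<in> {a \<in> Cell ?S. Src ?S a = m \<and> Tgt ?S a = m}"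
        using u by (simp only: mem_Collect_eq lax_slice_simps)
    qed
    finally have cells: "Arr (hom_cat ?S P (Dom A f, ?\<nu>)) = {?u}" .
    \<comment> \<open>Needed for the last premise of \<open>isomorphic_terminal_catI\<close>:
      \<open>?u\<close> composed vertically with itself is \<open>?u\<close>.\<close>
    have "Idt2 A (T1 \<mu> 0) \<bullet>\<^bsub>A\<^esub> Idt2 A (T1 \<mu> 0) = Idt2 A (T1 \<mu> 0)"
      using VCmp_Idt2_left[of "Idt2 A (T1 \<mu> 0)"] \<mu>0(1) by (simp add: typing)
    then show "isomorphic_categories (hom_cat ?S P (Dom A f, ?\<nu>)) terminal_cat"
      by (intro isomorphic_terminal_catI[OF _ cells, of m])
        (simp_all add: hom_cat_def hom, simp_all add: lax_slice_simps m_def)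
  qed
qed

section \<open>Normal forms for the 2-cells of the generated 2-category\<close>

lemma example_simps [simp]:
  "GOb example_computad = UNIV" "GArr example_computad = UNIV" "GCell example_computad = UNIV"
  "GSrc example_computad c = (ObX, [Alpha0, Eff], ObB)" "GTgt example_computad c = (ObX, [Alpha1], ObB)"
  by (simp_all add: example_computad_def)

text \<open>No generator leaves \<open>ObB\<close>. Hence only an identity path can follow \<alpha>
  in a whiskering.\<close>

lemma example_path_from_ObB:
  assumes "p \<in> paths example_computad" "psrc p = ObB"
  shows "p = (ObB, [], ObB)"
proof -
  obtain x gs y where p: "p = (x, gs, y)" by (cases p)
  have "(x, gs, y) \<in> paths example_computad" "x = ObB" using assms p by simp_all
  then show ?thesis unfolding p
    by cases (auto simp: example_computad_def split: gen_arr.splits)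
qed

text \<open>No generator ends at \<open>ObX\<close>. Hence only an identity path can precede
  \<alpha> in a whiskering.\<close>

lemma example_path_to_ObX:
  assumes "p \<in> paths example_computad" "ptgt p = ObX"
  shows "p = (ObX, [], ObX)"
proof -
  have "(x, gs, y) \<in> paths example_computad \<Longrightarrow> y = ObX \<Longrightarrow> x = ObX \<and> gs = []" for x gs y
    by (induction rule: paths.induct) (auto simp: example_computad_def split: gen_arr.splits)
  then show ?thesis using assms by (cases p) auto
qed

text \<open>By induction on the typing derivation. Two copies of \<alpha> never compose: vertically
  because its source and target are different paths, horizontally because \<open>ObB\<close> is not
  \<open>ObX\<close>. Any other composite involving \<alpha> has an identity as its other factor and
  reduces to \<alpha> by a unit law.\<close>

lemma example_typed_normal_form:
  fixes a :: "(gen_ob, gen_arr, gen_cell) cell_term"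
  assumes "typed example_computad a p q"
  shows "p = q \<and> term_eq example_computad a (IdT p) \<or>
    p = (ObX, [Alpha0, Eff], ObB) \<and> q = (ObX, [Alpha1], ObB) \<and> term_eq example_computad a (GenT Alpha)"
  using assms
proof (induction rule: typed.induct)
  case (IdT p)
  then show ?case by (auto intro: term_eq.refl typed.IdT)
next
  case (GenT c)
  then show ?case using term_eq.refl[OF typed.GenT[OF GenT]] by (cases c) simp
next
  case (VT a p q b r)
  note tp = typed_paths[OF well_formed_example VT(1)] typed_paths[OF well_formed_example VT(2)]
  have id: "typed example_computad (IdT q) q q" using tp by (simp add: typed.IdT)
  have gen: "typed example_computad (GenT Alpha) (ObX, [Alpha0, Eff], ObB) (ObX, [Alpha1], ObB)"
    using typed.GenT[of Alpha example_computad] by simp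
  \<comment> \<open>Congruence followed by transitivity: both factors are replaced by their normal
    forms, and the resulting small term is then simplified.\<close>
  note cong = term_eq.trans[OF term_eq.VT_cong[OF VT(1,2)]]
  from VT(3,4) show ?case
  proof (elim disjE conjE)
    assume *: "p = q" "q = r" "term_eq example_computad a (IdT p)" "term_eq example_computad b (IdT q)"
    from cong[OF *(3,4)] show ?thesis using term_eq.VT_unit_left[OF id] *(1,2) by blast
  next
    assume *: "p = q" "term_eq example_computad a (IdT p)" "q = (ObX, [Alpha0, Eff], ObB)"
      "r = (ObX, [Alpha1], ObB)" "term_eq example_computad b (GenT Alpha)"
    from cong[OF *(2,5)] show ?thesis using term_eq.VT_unit_right[OF gen] * by blast
  next
    assume *: "p = (ObX, [Alpha0, Eff], ObB)" "q = (ObX, [Alpha1], ObB)"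
      "term_eq example_computad a (GenT Alpha)" "q = r" "term_eq example_computad b (IdT q)"
    from cong[OF *(3,5)] show ?thesis using term_eq.VT_unit_left[OF gen] * by blast
  \<comment> \<open>The remaining case is \<alpha> vertically after \<alpha>, which would equate the
    paths \<open>[Alpha1]\<close> and \<open>[Alpha0, Eff]\<close>.\<close>
  qed simp
next
  case (HT a p q b p' q')
  note tp = typed_paths[OF well_formed_example HT(1)] typed_paths[OF well_formed_example HT(2)]
  have gen: "typed example_computad (GenT Alpha) (ObX, [Alpha0, Eff], ObB) (ObX, [Alpha1], ObB)"
    using typed.GenT[of Alpha example_computad] by simp
  note cong = term_eq.trans[OF term_eq.HT_cong[OF HT(1,2,3)]]
  from HT(4,5) show ?case
  proof (elim disjE conjE)
    assume *: "p = q" "p' = q'" "term_eq example_computad a (IdT p)" "term_eq example_computad b (IdT p')"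
    have "term_eq example_computad (HT (IdT p') (IdT p)) (IdT (pcomp p' p))"
      using tp HT(3) by (intro term_eq.HT_IdT) blast+
    from cong[OF *(3,4) this] show ?thesis using *(1,2) by blast
  next
    assume *: "p = q" "term_eq example_computad a (IdT p)" "p' = (ObX, [Alpha0, Eff], ObB)"
      "q' = (ObX, [Alpha1], ObB)" "term_eq example_computad b (GenT Alpha)"
    have "ptgt p = ObX" using HT(3) *(3) by simp
    then have p: "p = (ObX, [], ObX)" using example_path_to_ObX tp by blast
    then show ?thesis using cong[OF *(2,5)] term_eq.HT_unit_right[OF gen] *(1,3,4) by simp
  next
    assume *: "p = (ObX, [Alpha0, Eff], ObB)" "q = (ObX, [Alpha1], ObB)"
      "term_eq example_computad a (GenT Alpha)" "p' = q'" "term_eq example_computad b (IdT p')"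
    have "psrc p' = ObB" using HT(3) *(1) by simp
    then have p': "p' = (ObB, [], ObB)" using example_path_from_ObB tp by blast
    then show ?thesis using cong[OF *(3,5)] term_eq.HT_unit_left[OF gen] *(1,2,4) by simp
  next
    \<comment> \<open>Here \<alpha> would stand horizontally after \<alpha>, forcing
      \<open>ObX = ObB\<close>.\<close>
    assume "p = (ObX, [Alpha0, Eff], ObB)" "p' = (ObX, [Alpha0, Eff], ObB)"
    then show ?thesis using HT(3) by simp
  qed
qed

text \<open>The source and target of \<alpha> differ, so the boundary decides which normal form
  occurs, and parallel terms reduce to the same one.\<close>

lemma locally_thin_exA: "locally_thin exA"
proof (intro locally_thin.intro locally_thin_axioms.intro two_category_exA)
  fix a b
  assume ab: "a \<in> Cell exA" "b \<in> Cell exA" "Src exA a = Src exA b" "Tgt exA a = Tgt exA b"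
  obtain p s q where a: "a = (p, term_class example_computad s, q)" "typed example_computad s p q"
    using ab(1) unfolding free_Cell_iff by blast
  obtain p' t q' where "b = (p', term_class example_computad t, q')" "typed example_computad t p' q'"
    using ab(2) unfolding free_Cell_iff by blast
  then have b: "b = (p, term_class example_computad t, q)" "typed example_computad t p q"
    using ab(3,4) a(1) by simp_all
  have "term_eq example_computad s t"
    using example_typed_normal_form[OF a(2)] example_typed_normal_form[OF b(2)]
    by (elim disjE conjE) (simp_all, (blast intro: term_eq.trans term_eq.sym)+)
  then show "a = b" using a(1) b(1) term_class_eq by simp
qed

text \<open>Since \<alpha> ends at \<open>ObB\<close>, only the identity alternative of the normal
  form remains.\<close>

lemma exA_cell_into_ObA: "a \<in> Cell exA \<Longrightarrow> Cod exA (Src exA a) = ObA \<Longrightarrow> Tgt exA a = Src exA a"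
  using example_typed_normal_form by (fastforce simp: free_Cell_iff)

section \<open>The lax-cone that post-composition misses\<close>

lemma not_surjective_cone_functor:
  "\<not> surjective_on_objects (hom_cat exA ObX ObA)
      (hom_cat (Lax Two exA) (Delta0 Two exA ObX) (arrow_functor exA exf))
      (cone_functor Two exA (id_cone exA exf))"
proof
  interpret locally_thin_target exA Two
    by (intro locally_thin_target.intro locally_thin_exA two_category_Two)
  let ?a0 = "(ObX, [Alpha0], ObA)" and ?a1 = "(ObX, [Alpha1], ObB)"
  \<comment> \<open>The generator \<alpha> sits at the arrow from 0 to 1, with source
    \<open>pcomp exf ?a0\<close>. The other two values are the identities forced by the unit
    axiom.\<close>
  let ?T2 = "\<lambda>p::nat \<times> nat. if p = (0, 0) then Idt2 exA ?a0 else if p = (0, 1)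
    then (pcomp exf ?a0, term_class example_computad (GenT Alpha), ?a1) else Idt2 exA ?a1"
  let ?\<mu> = "\<lparr>TSrc = Delta0 Two exA ObX, TTgt = arrow_functor exA exf,
    T1 = (\<lambda>i\<in>{0, 1}. if i = 0 then ?a0 else ?a1), T2 = (\<lambda>p\<in>Arr Two. ?T2 p)\<rparr>"
  have paths: "?a0 \<in> paths example_computad" "?a1 \<in> paths example_computad"
    by (auto intro!: paths.intros simp: example_computad_def)
  have cells: "(?a0, term_class example_computad (IdT ?a0), ?a0) \<in> Cell exA"
    "(?a1, term_class example_computad (IdT ?a1), ?a1) \<in> Cell exA"
    "((ObX, [Alpha0, Eff], ObB), term_class example_computad (GenT Alpha), ?a1) \<in> Cell exA"
    using free_CellI[OF typed.IdT] paths free_CellI[OF typed.GenT[of Alpha example_computad]]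
    by simp_all
  have "lax_natural Two exA ?\<mu>"
    by (rule lax_naturalI)
      (use two_functor_Delta0[OF two_category_exA two_category_Two, of ObX] paths cells
        two_functor_arrow_functor[OF two_category_exA exf_Arr] in
        \<open>auto simp: hom_def Delta0_def arrow_functor_def\<close>)
  then have "?\<mu> \<in> Ob (hom_cat (Lax Two exA) (Delta0 Two exA ObX) (arrow_functor exA exf))"
    by (simp add: hom_cat_def hom_def)
  moreover assume "surjective_on_objects (hom_cat exA ObX ObA)
      (hom_cat (Lax Two exA) (Delta0 Two exA ObX) (arrow_functor exA exf))
      (cone_functor Two exA (id_cone exA exf))"
  ultimately obtain h where "onOb (cone_functor Two exA (id_cone exA exf)) h = ?\<mu>"
    unfolding surjective_on_objects_def by blast
  \<comment> \<open>The two cones are compared at the object 1, where the image of \<open>h\<close>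
    has component \<open>pcomp exf h\<close>.\<close>
  then have "T1 (id_cone exA exf \<odot>\<^bsub>Lax Two exA\<^esub> Delta1 Two exA h) 1 = T1 ?\<mu> 1"
    by (simp add: cone_functor_def functor_comp_def post_comp_def Delta_def)
  then have "pcomp exf h = ?a1" by (simp add: Lax_def Let_def id_cone_def Delta1_def)
  \<comment> \<open>The generator list of \<open>pcomp exf h\<close> ends in \<open>Eff\<close>,
    while that of \<open>?a1\<close> is \<open>[Alpha1]\<close>.\<close>
  then show False by (cases h) (simp add: append_eq_Cons_conv)
qed

theorem mainTheorem17:
  shows "two_terminal (lax_slice Two exA (arrow_functor exA exf)) (ObA, id_cone exA exf)
    \<and> \<not> surjective_on_objects (hom_cat exA ObX ObA)
          (hom_cat (Lax Two exA) (Delta0 Two exA ObX) (arrow_functor exA exf))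
          (cone_functor Two exA (id_cone exA exf))
    \<and> \<not> lax_limit Two exA (arrow_functor exA exf) (ObA, id_cone exA exf)"
proof (intro conjI not_surjective_cone_functor)
  show "two_terminal (lax_slice Two exA (arrow_functor exA exf)) (ObA, id_cone exA exf)"
    using two_terminal_id_cone[OF locally_thin_exA exf_Arr] exA_cell_into_ObA by simp
  show "\<not> lax_limit Two exA (arrow_functor exA exf) (ObA, id_cone exA exf)"
    \<comment> \<open>A lax-limit would require an isomorphism at \<open>ObX\<close> in particular,
      and that would be surjective on objects.\<close>
    using not_surjective_cone_functor isomorphism_surjective_on_objects
    by (fastforce simp: lax_limit_def)
qed

end
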